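(* The convex polytope of $V^*$ defined by $$F_{P^\vee}:=\{\lambda\in V^* : \langle\lambda,\alpha_0\rangle\le1,\ \text{and for all }\alpha\in\Pi:\ \langle\lambda,\alpha\rangle\ge0\ \text{ and }\ (n_\alpha=1\Rightarrow\langle\lambda,\alpha_0+\alpha\rangle\le1)\}$$ is a fundamental domain for the extended affine Weyl group $\widehat{W}_{\mathrm a}$ acting on $V^*$. Moreover, if $\lambda\in F_{P^\vee}$ is an interior point and $1\ne\widehat{w}\in\widehat{W}_{\mathrm a}$, then $\widehat{w}(\lambda)\notin F_{P^\vee}$.
   Context: $\Phi$ is a reduced crystallographic irreducible root system in $V=\mathbb{R}\Phi$, with simple system $\Pi$, Weyl group $W$ and highest root $\alpha_0=\sum_{\alpha\in\Pi}n_\alpha\alpha$. $V^*$ is the dual of $V$, with pairing $\langle\cdot,\cdot\rangle:V^*\times V\to\mathbb{R}$; $W$ acts on $V^*$ by $s_\alpha(y)=y-\langle y,\alpha\rangle\alpha^\vee$, with $\alpha^\vee$ the coroot. The coweight lattice is $P^\vee=\{\lambda\in V^*:\langle\lambda,\alpha\rangle\in\mathbb{Z}\ \forall\alpha\in\Phi\}$. The extended affine Weyl group is $\widehat{W}_{\mathrm a}=\mathrm{t}(P^\vee)\rtimes W$, where $\mathrm{t}(P^\vee)$ is the group of translations by elements of $P^\vee$. A fundamental domain for the action of a discrete group $G$ on a topological space $Z$ is a closed connected subspace $\mathcal{F}\subseteq Z$ such that $\mathcal{F}\cap g\mathcal{F}$ has empty interior for every $1\ne g\in G$, and $Z=\bigcup_{g\in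 G}g\mathcal{F}$. *)

theory Defs
  imports
    "HOL-Analysis.Analysis"
    "HOL-Algebra.Generated_Groups"
    "HOL-Algebra.Group_Action"
begin

section \<open>Root systems\<close>

text \<open>
  The ambient space \<open>V\<close> is the whole of a type of class \<open>euclidean_space\<close>. The class only supplies
  finite-dimensionality: the inner product is never mentioned and is not assumed to be related to
  the roots. The dual space \<open>V\<^sup>*\<close> is \<open>'a \<Rightarrow>\<^sub>L real\<close> (all linear functionals are bounded, and the norm
  topology is the usual topology of a finite-dimensional real space); the pairing of \<open>y\<close> with \<open>v\<close>
  is \<open>blinfun_apply y v\<close>.

  Since no invariant inner product is fixed, coroots are characterised as elements of \<open>V\<^sup>*\<close>:
  \<open>c\<close> is a coroot of \<open>\<alpha>\<close> if it takes the value 2 at \<open>\<alpha>\<close> and the associated reflection of \<open>V\<close>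
  preserves \<open>\<Phi>\<close>. For an invariant inner product this is the functional
  \<open>v \<mapsto> 2 (v, \<alpha>) / (\<alpha>, \<alpha>)\<close>.
\<close>

definition is_coroot :: "'a::euclidean_space set \<Rightarrow> 'a \<Rightarrow> ('a \<Rightarrow>\<^sub>L real) \<Rightarrow> bool" where
  "is_coroot \<Phi> \<alpha> c \<longleftrightarrow>
     blinfun_apply c \<alpha> = 2 \<and> (\<lambda>v. v - blinfun_apply c v *\<^sub>R \<alpha>) ` \<Phi> = \<Phi>"

definition coroot :: "'a::euclidean_space set \<Rightarrow> 'a \<Rightarrow> 'a \<Rightarrow>\<^sub>L real" where
  "coroot \<Phi> \<alpha> = (THE c. is_coroot \<Phi> \<alpha> c)"

definition crystallographic_root_system :: "'a::euclidean_space set \<Rightarrow> bool" where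
  "crystallographic_root_system \<Phi> \<longleftrightarrow>
     finite \<Phi> \<and> 0 \<notin> \<Phi> \<and> span \<Phi> = UNIV \<and>
     (\<forall>\<alpha>\<in>\<Phi>. \<exists>c. is_coroot \<Phi> \<alpha> c) \<and>
     (\<forall>\<alpha>\<in>\<Phi>. \<forall>\<beta>\<in>\<Phi>. blinfun_apply (coroot \<Phi> \<alpha>) \<beta> \<in> \<int>)"

definition reduced_roots :: "'a::euclidean_space set \<Rightarrow> bool" where
  "reduced_roots \<Phi> \<longleftrightarrow> (\<forall>\<alpha>\<in>\<Phi>. \<forall>c::real. c *\<^sub>R \<alpha> \<in> \<Phi> \<longrightarrow> c = 1 \<or> c = -1)"

text \<open>Without an inner product, \<open>\<alpha>\<close> and \<open>\<beta>\<close> are orthogonal when both pairings vanish.\<close>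

definition irreducible_roots :: "'a::euclidean_space set \<Rightarrow> bool" where
  "irreducible_roots \<Phi> \<longleftrightarrow> \<Phi> \<noteq> {} \<and>
     \<not> (\<exists>A B. A \<noteq> {} \<and> B \<noteq> {} \<and> A \<union> B = \<Phi> \<and> A \<inter> B = {} \<and>
          (\<forall>\<alpha>\<in>A. \<forall>\<beta>\<in>B. blinfun_apply (coroot \<Phi> \<alpha>) \<beta> = 0 \<and> blinfun_apply (coroot \<Phi> \<beta>) \<alpha> = 0))"

definition simple_system :: "'a::euclidean_space set \<Rightarrow> 'a set \<Rightarrow> bool" where
  "simple_system \<Phi> \<Delta> \<longleftrightarrow>
     \<Delta> \<subseteq> \<Phi> \<and> independent \<Delta> \<and> span \<Delta> = UNIV \<and>
     (\<forall>\<beta>\<in>\<Phi>. (\<forall>\<alpha>\<in>\<Delta>. representation \<Delta> \<beta> \<alpha> \<in> \<nat>) \<or> (\<forall>\<alpha>\<in>\<Delta>. - representation \<Delta> \<beta> \<alpha> \<in> \<nat>))"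

text \<open>The coefficient \<open>n\<^sub>\<alpha>\<close> of the highest root \<open>\<alpha>\<^sub>0\<close> is \<open>representation \<Delta> \<alpha>\<^sub>0 \<alpha>\<close>.\<close>

definition highest_root :: "'a::euclidean_space set \<Rightarrow> 'a set \<Rightarrow> 'a \<Rightarrow> bool" where
  "highest_root \<Phi> \<Delta> \<alpha>\<^sub>0 \<longleftrightarrow>
     \<alpha>\<^sub>0 \<in> \<Phi> \<and> (\<forall>\<beta>\<in>\<Phi>. \<forall>\<alpha>\<in>\<Delta>. representation \<Delta> \<beta> \<alpha> \<le> representation \<Delta> \<alpha>\<^sub>0 \<alpha>)"

section \<open>The extended affine Weyl group\<close>

definition coweight_lattice :: "'a::euclidean_space set \<Rightarrow> ('a \<Rightarrow>\<^sub>L real) set" where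
  "coweight_lattice \<Phi> = {y. \<forall>\<alpha>\<in>\<Phi>. blinfun_apply y \<alpha> \<in> \<int>}"

definition dual_reflection ::
  "'a::euclidean_space set \<Rightarrow> 'a \<Rightarrow> ('a \<Rightarrow>\<^sub>L real) \<Rightarrow> ('a \<Rightarrow>\<^sub>L real)" where
  "dual_reflection \<Phi> \<alpha> y = y - blinfun_apply y \<alpha> *\<^sub>R coroot \<Phi> \<alpha>"

text \<open>
  The Weyl group acts faithfully on \<open>V\<^sup>*\<close>, so it is taken to be a group of transformations of \<open>V\<^sup>*\<close>,
  as is the group of translations. \<open>BijGroup UNIV\<close> is the group of all bijections of the
  type onto itself under composition; in it the semidirect product is the product set of the
  translation subgroup and \<open>W\<close>.
\<close>

definition weyl_group ::
  "'a::euclidean_space set \<Rightarrow> (('a \<Rightarrow>\<^sub>L real) \<Rightarrow> ('a \<Rightarrow>\<^sub>L real)) set" where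
  "weyl_group \<Phi> = generate (BijGroup UNIV) (dual_reflection \<Phi> ` \<Phi>)"

definition translation_group :: "'b::real_vector set \<Rightarrow> ('b \<Rightarrow> 'b) set" where
  "translation_group L = (\<lambda>l x. x + l) ` L"

definition extended_affine_weyl_group ::
  "'a::euclidean_space set \<Rightarrow> (('a \<Rightarrow>\<^sub>L real) \<Rightarrow> ('a \<Rightarrow>\<^sub>L real)) monoid" where
  "extended_affine_weyl_group \<Phi> =
     (BijGroup UNIV)
       \<lparr>carrier := translation_group (coweight_lattice \<Phi>) <#>\<^bsub>BijGroup UNIV\<^esub> weyl_group \<Phi>\<rparr>"

section \<open>Fundamental domains\<close>

text \<open>
  Here \<open>Z\<close> is a whole topological type, on which the (abstract, i.e. discrete) group \<open>G\<close> acts by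
  homeomorphisms via \<open>\<phi>\<close>; that this is an action is part of the definition.
\<close>

definition fundamental_domain ::
  "('g, 'm) monoid_scheme \<Rightarrow> ('g \<Rightarrow> 'z \<Rightarrow> 'z) \<Rightarrow> 'z::topological_space set \<Rightarrow> bool" where
  "fundamental_domain G \<phi> F \<longleftrightarrow>
     group_action G UNIV \<phi> \<and> (\<forall>g\<in>carrier G. continuous_on UNIV (\<phi> g)) \<and>
     closed F \<and> connected F \<and>
     (\<forall>g\<in>carrier G. g \<noteq> \<one>\<^bsub>G\<^esub> \<longrightarrow> interior (F \<inter> \<phi> g ` F) = {}) \<and>
     (\<Union>g\<in>carrier G. \<phi> g ` F) = UNIV"

definition coweight_polytope ::
  "'a::euclidean_space set \<Rightarrow> 'a \<Rightarrow> ('a \<Rightarrow>\<^sub>L real) set" where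
  "coweight_polytope \<Delta> \<alpha>\<^sub>0 =
     {y. blinfun_apply y \<alpha>\<^sub>0 \<le> 1 \<and>
         (\<forall>\<alpha>\<in>\<Delta>. 0 \<le> blinfun_apply y \<alpha> \<and>
                (representation \<Delta> \<alpha>\<^sub>0 \<alpha> = 1 \<longrightarrow> blinfun_apply y (\<alpha>\<^sub>0 + \<alpha>) \<le> 1))}"

section \<open>Uniqueness of coroots\<close>

lemma is_coroot_unique:
  fixes \<Phi> :: "'a::euclidean_space set"
  assumes fin: "finite \<Phi>" and sp: "span \<Phi> = UNIV"
    and c: "is_coroot \<Phi> \<alpha> c" and d: "is_coroot \<Phi> \<alpha> d"
  shows "c = d"
proof -
  define e where "e = d - c"
  have ca: "blinfun_apply c \<alpha> = 2" and da: "blinfun_apply d \<alpha> = 2"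
    using c d by (auto simp: is_coroot_def)
  have ea: "blinfun_apply e \<alpha> = 0"
    by (simp add: e_def ca da blinfun.diff_left)
  have \<alpha>0: "\<alpha> \<noteq> 0" using ca by auto
  have step: "v + blinfun_apply e v *\<^sub>R \<alpha> \<in> \<Phi>" if "v \<in> \<Phi>" for v
  proof -
    define u where "u = v - blinfun_apply d v *\<^sub>R \<alpha>"
    have "u \<in> \<Phi>" using d that unfolding is_coroot_def u_def by blast
    then have "u - blinfun_apply c u *\<^sub>R \<alpha> \<in> \<Phi>" using c unfolding is_coroot_def by blast
    moreover have "blinfun_apply c u = blinfun_apply c v - 2 * blinfun_apply d v"
      by (simp add: u_def ca blinfun.diff_right blinfun.scaleR_right)
    moreover have "u - (blinfun_apply c v - 2 * blinfun_apply d v) *\<^sub>R \<alpha> =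
        v + blinfun_apply e v *\<^sub>R \<alpha>"
      by (simp add: u_def e_def blinfun.diff_left algebra_simps scaleR_2 flip: scaleR_scaleR)
    ultimately show ?thesis by simp
  qed
  have "blinfun_apply e v = 0" if v: "v \<in> \<Phi>" for v
  proof (rule ccontr)
    assume ne: "blinfun_apply e v \<noteq> 0"
    have mem: "v + (real n * blinfun_apply e v) *\<^sub>R \<alpha> \<in> \<Phi>" for n
    proof (induction n)
      case (Suc n)
      show ?case
        using step[OF Suc.IH]
        by (simp add: ea blinfun.add_right blinfun.scaleR_right algebra_simps)
    qed (simp add: v)
    have "inj (\<lambda>n. v + (real n * blinfun_apply e v) *\<^sub>R \<alpha>)"
      by (rule injI) (use ne \<alpha>0 in simp)
    then have "infinite (range (\<lambda>n. v + (real n * blinfun_apply e v) *\<^sub>R \<alpha>))"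
      using finite_imageD by blast
    then show False using mem fin by (meson finite_subset image_subsetI)
  qed
  then have "blinfun_apply e v = 0" for v
    by (rule linear_eq_0_on_span[OF bounded_linear.linear[OF blinfun.bounded_linear_right], where b = \<Phi>]) (auto simp: sp)
  then have "e = 0" by (intro blinfun_eqI) simp
  then show ?thesis by (simp add: e_def)
qed

lemma coroot_eqI:
  assumes "finite \<Phi>" "span \<Phi> = UNIV" "is_coroot \<Phi> \<alpha> c"
  shows "coroot \<Phi> \<alpha> = c"
  unfolding coroot_def using assms is_coroot_unique by blast

end

theory Submission
  imports Defs
begin

text \<open>
  Let \<open>P\<close> be the coweight lattice, \<open>F\<close> the polytope, and let the gauge of \<open>y\<close> be the maximum of
  \<open>\<langle>y, \<beta>\<rangle>\<close> over all roots \<open>\<beta>\<close>. The gauge is a Weyl-invariant norm on \<open>V\<^sup>*\<close>, equal to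
  \<open>\<langle>y, \<alpha>\<^sub>0\<rangle>\<close> when \<open>y\<close> is dominant. The point is that \<open>F\<close> is the set of dominant points that are at
  least as close to \<open>0\<close>, measured by the gauge, as to any other point of \<open>P\<close>: it is the part in the
  dominant chamber of a Voronoi cell, for the gauge instead of a Euclidean norm. The argument does
  not need to identify the stabilizer of the fundamental alcove with symmetries of the affine Dynkin
  diagram.

  \<^emph>\<open>Covering.\<close> Every coset of \<open>P\<close> contains a point of minimal gauge, and among those one that is
  minimal for an invariant quadratic form; move it into the dominant chamber by the Weyl group. If
  the result \<open>x\<close> had \<open>\<langle>x, \<alpha>\<^sub>0\<rangle> > 1\<close>, subtracting the coroot of \<open>\<alpha>\<^sub>0\<close> would not increase the gauge
  and would decrease the form. If \<open>n\<^sub>\<alpha> = 1\<close>, with fundamental coweight \<open>\<omega>\<close>, the gauge of \<open>x - \<omega>\<close> is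
  at most \<open>1 - \<langle>x, \<alpha>\<rangle>\<close>, and minimality gives \<open>\<langle>x, \<alpha>\<^sub>0 + \<alpha>\<rangle> \<le> 1\<close>. So \<open>x \<in> F\<close>
  (\<open>minimal_dominant_in_F\<close>, \<open>F_covers\<close>).

  \<^emph>\<open>Disjointness.\<close> Conversely, translating a point of \<open>F\<close> by a non-zero coweight does not decrease
  its gauge, and increases it if the point is interior (\<open>gauge_translate\<close>,
  \<open>gauge_translate_interior\<close>). If \<open>y\<close> is interior and \<open>w y + l \<in> F\<close> with \<open>w\<close> in the Weyl group
  and \<open>0 \<noteq> l \<in> P\<close>, then comparing the gauges of \<open>y\<close> and \<open>w y + l\<close> in both directions is
  contradictory. Hence \<open>l = 0\<close>, and \<open>w = 1\<close> because a Weyl group element that sends a strictly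
  dominant point to a dominant one is trivial (\<open>dual_word_trivial\<close>), by the exchange condition
  for words in the simple reflections.
\<close>

section \<open>Functionals on a Euclidean space\<close>

lemma ex_blinfun_eq:
  fixes f :: "'a::euclidean_space \<Rightarrow> real"
  assumes "linear f"
  shows "\<exists>y. \<forall>v. blinfun_apply y v = f v"
  using assms bounded_linear_Blinfun_apply linear_conv_bounded_linear by metis

lemma blinfun_apply_zero_on_span:
  fixes y :: "'a::euclidean_space \<Rightarrow>\<^sub>L real"
  assumes "\<And>v. v \<in> S \<Longrightarrow> blinfun_apply y v = 0" and "v \<in> span S"
  shows "blinfun_apply y v = 0"
  by (rule linear_eq_0_on_span[OF bounded_linear.linear[OF blinfun.bounded_linear_right], where b = S])
    (use assms in auto)

lemma blinfun_eqI_span: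
  fixes y z :: "'a::euclidean_space \<Rightarrow>\<^sub>L real"
  assumes "span S = UNIV" and "\<And>v. v \<in> S \<Longrightarrow> blinfun_apply y v = blinfun_apply z v"
  shows "y = z"
proof (rule blinfun_eqI)
  fix v
  have "blinfun_apply (y - z) v = 0"
    by (rule blinfun_apply_zero_on_span[of S]) (use assms in \<open>auto simp: blinfun.bilinear_simps\<close>)
  then show "blinfun_apply y v = blinfun_apply z v"
    by (simp add: blinfun.bilinear_simps)
qed

lemma finite_blinfuns_with_finite_values:
  fixes S :: "'a::euclidean_space set"
  assumes "finite S" "span S = UNIV" "\<And>v. v \<in> S \<Longrightarrow> finite (T v)"
  shows "finite {y :: 'a \<Rightarrow>\<^sub>L real. \<forall>v\<in>S. blinfun_apply y v \<in> T v}"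
proof (rule inj_on_finite)
  show "inj_on (\<lambda>y. restrict (blinfun_apply y) S) {y. \<forall>v\<in>S. blinfun_apply y v \<in> T v}"
    by (rule inj_onI, rule blinfun_eqI_span[OF assms(2)]) (metis restrict_apply')
  show "(\<lambda>y. restrict (blinfun_apply y) S) ` {y. \<forall>v\<in>S. blinfun_apply y v \<in> T v} \<subseteq> PiE S T"
    by auto
  show "finite (PiE S T)"
    using assms by (intro finite_PiE) auto
qed

lemma interior_strict_halfspace:
  fixes y :: "'a::euclidean_space \<Rightarrow>\<^sub>L real"
  assumes y: "y \<in> interior F" and le: "\<And>z. z \<in> F \<Longrightarrow> blinfun_apply z v \<le> c" and v: "v \<noteq> 0"
  shows "blinfun_apply y v < c"
proof -
  obtain U where U: "open U" "y \<in> U" "U \<subseteq> F"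
    using y by (auto simp: interior_def)
  define f where "f t = y + t *\<^sub>R blinfun_inner_left v" for t :: real
  have "open (f -` U)"
    by (rule open_vimage[OF U(1)]) (auto simp: f_def intro!: continuous_intros)
  moreover have "0 \<in> f -` U"
    using U by (simp add: f_def)
  ultimately obtain e where e: "e > 0" "ball 0 e \<subseteq> f -` U"
    by (meson open_contains_ball)
  have "e/2 \<in> ball 0 e"
    using e by simp
  then have "f (e/2) \<in> F"
    using e U by blast
  from le[OF this] have "blinfun_apply y v + e/2 * (v \<bullet> v) \<le> c"
    by (simp add: f_def blinfun.bilinear_simps)
  moreover have "e/2 * (v \<bullet> v) > 0"
    using e v by simp
  ultimately show ?thesis
    by linarith
qed

text \<open>
  The halfspace description of polytopes is a fact about Euclidean spaces; it is transported to the
  dual space along the isomorphism that sends \<open>x\<close> to the functional \<open>v \<mapsto> v \<bullet> x\<close>.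
\<close>

lemma polytope_dual_halfspaces:
  fixes H :: "('a::euclidean_space \<times> real) set"
  assumes fin: "finite H" and F: "F = {y. \<forall>(v, c)\<in>H. blinfun_apply y v \<le> c}"
    and S: "span S = UNIV"
    and bdd: "\<And>y v. y \<in> F \<Longrightarrow> v \<in> S \<Longrightarrow> \<bar>blinfun_apply y v\<bar> \<le> K v"
  shows "polytope F"
proof -
  define F' where "F' = {x :: 'a. blinfun_inner_left x \<in> F}"
  have lin: "linear (blinfun_inner_left :: 'a \<Rightarrow> _)"
    using bounded_linear_blinfun_inner_left by (rule bounded_linear.linear)
  have surj: "\<exists>x. y = blinfun_inner_left x" for y :: "'a \<Rightarrow>\<^sub>L real"
  proof
    show "y = blinfun_inner_left (\<Sum>b\<in>Basis. blinfun_apply y b *\<^sub>R b)"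
      by (rule blinfun_eqI_span[OF span_Basis])
        (auto simp: inner_sum_right inner_Basis if_distrib cong: if_cong)
  qed
  have "F' = \<Inter> ((\<lambda>(v, c). {x. v \<bullet> x \<le> c}) ` H)"
    unfolding F'_def F by auto
  then have poly: "polyhedron F'"
    using fin by (auto intro!: polyhedron_Inter polyhedron_halfspace_le)
  have "\<exists>B. \<forall>x\<in>F'. \<bar>v \<bullet> x\<bar> \<le> B" for v
  proof -
    have "v \<in> span S"
      using S by simp
    then show ?thesis
    proof (induction rule: span_induct_alt)
      case base
      show ?case
        by auto
    next
      case (step c u w)
      then obtain B where B: "\<forall>x\<in>F'. \<bar>w \<bullet> x\<bar> \<le> B"
        by blast
      have "\<bar>(c *\<^sub>R u + w) \<bullet> x\<bar> \<le> \<bar>c\<bar> * K u + B" if "x \<in> F'" for x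
      proof -
        have "\<bar>u \<bullet> x\<bar> \<le> K u"
          using bdd[of "blinfun_inner_left x" u] step.hyps that by (simp add: F'_def)
        then have "\<bar>c * (u \<bullet> x)\<bar> \<le> \<bar>c\<bar> * K u"
          by (simp add: abs_mult mult_left_mono)
        moreover have "\<bar>w \<bullet> x\<bar> \<le> B"
          using B that by blast
        ultimately show ?thesis
          by (simp add: inner_add_left)
      qed
      then show ?case
        by blast
    qed
  qed
  then obtain B where B: "\<And>v x. x \<in> F' \<Longrightarrow> \<bar>v \<bullet> x\<bar> \<le> B v"
    by metis
  have "norm x \<le> (\<Sum>b\<in>Basis. B b)" if "x \<in> F'" for x
  proof -
    have "norm x \<le> (\<Sum>b\<in>Basis. \<bar>x \<bullet> b\<bar>)"
      by (rule norm_le_l1)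
    also have "\<dots> \<le> (\<Sum>b\<in>Basis. B b)"
      using B[OF that] by (intro sum_mono) (simp add: inner_commute)
    finally show ?thesis .
  qed
  then have "bounded F'"
    unfolding bounded_iff by blast
  then have "polytope F'"
    using poly polytope_eq_bounded_polyhedron by blast
  then obtain X where X: "finite X" "F' = convex hull X"
    by (auto simp: polytope_def)
  have "F = blinfun_inner_left ` F'"
    using surj by (force simp: F'_def)
  also have "\<dots> = convex hull (blinfun_inner_left ` X)"
    by (simp add: X(2) convex_hull_linear_image[OF lin])
  finally show ?thesis
    using X(1) by (auto simp: polytope_def)
qed

section \<open>The group of all bijections of a type\<close>

lemma carrier_BijGroup: "carrier (BijGroup UNIV) = {f. bij f}"
  by (auto simp: BijGroup_def Bij_def)

lemma mult_BijGroup: "bij f \<Longrightarrow> bij g \<Longrightarrow> f \<otimes>\<^bsub>BijGroup UNIV\<^esub> g = (\<lambda>x. f (g x))"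
  by (auto simp: BijGroup_def Bij_def compose_def)

lemma one_BijGroup: "\<one>\<^bsub>BijGroup UNIV\<^esub> = (\<lambda>x. x)"
  by (simp add: BijGroup_def fun_eq_iff)

lemma inv_BijGroup:
  assumes "\<And>x. g (f x) = x" "\<And>x. f (g x) = x"
  shows "inv\<^bsub>BijGroup UNIV\<^esub> f = g"
proof (rule group.inv_equality[OF group_BijGroup])
  have "bij f" "bij g"
    using assms by (auto intro!: o_bij[of g f] o_bij[of f g])
  then show "g \<otimes>\<^bsub>BijGroup UNIV\<^esub> f = \<one>\<^bsub>BijGroup UNIV\<^esub>" "f \<in> carrier (BijGroup UNIV)"
      "g \<in> carrier (BijGroup UNIV)"
    by (simp_all add: mult_BijGroup one_BijGroup carrier_BijGroup assms)
qed

section \<open>Reflections and the invariant form\<close>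

text \<open>A root system with a chosen simple system.\<close>

locale based_root_system =
  fixes \<Phi> \<Delta> :: "'a::euclidean_space set"
  assumes root_system: "crystallographic_root_system \<Phi>"
    and reduced: "reduced_roots \<Phi>"
    and simple: "simple_system \<Phi> \<Delta>"
begin

abbreviation pairing :: "('a \<Rightarrow>\<^sub>L real) \<Rightarrow> 'a \<Rightarrow> real" ("\<langle>_,/ _\<rangle>") where
  "\<langle>y, v\<rangle> \<equiv> blinfun_apply y v"

abbreviation coeff :: "'a \<Rightarrow> 'a \<Rightarrow> real" where
  "coeff \<equiv> representation \<Delta>"

text \<open>The reflection of \<open>V\<close>; its transpose is \<^term>\<open>dual_reflection \<Phi> \<alpha>\<close>.\<close>

definition reflection :: "'a \<Rightarrow> 'a \<Rightarrow> 'a" where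
  "reflection \<alpha> v = v - \<langle>coroot \<Phi> \<alpha>, v\<rangle> *\<^sub>R \<alpha>"

lemma finite_roots: "finite \<Phi>"
  and zero_not_root: "0 \<notin> \<Phi>"
  and span_roots: "span \<Phi> = UNIV"
  using root_system by (auto simp: crystallographic_root_system_def)

lemma is_coroot_coroot: "\<alpha> \<in> \<Phi> \<Longrightarrow> is_coroot \<Phi> \<alpha> (coroot \<Phi> \<alpha>)"
  using root_system coroot_eqI[OF finite_roots span_roots]
  unfolding crystallographic_root_system_def by metis

lemma coroot_integral: "\<alpha> \<in> \<Phi> \<Longrightarrow> \<beta> \<in> \<Phi> \<Longrightarrow> \<langle>coroot \<Phi> \<alpha>, \<beta>\<rangle> \<in> \<int>"
  using root_system by (simp add: crystallographic_root_system_def)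

lemma coroot_self: "\<alpha> \<in> \<Phi> \<Longrightarrow> \<langle>coroot \<Phi> \<alpha>, \<alpha>\<rangle> = 2"
  using is_coroot_coroot by (simp add: is_coroot_def)

lemma reflection_image: "\<alpha> \<in> \<Phi> \<Longrightarrow> reflection \<alpha> ` \<Phi> = \<Phi>"
  using is_coroot_coroot by (simp add: is_coroot_def reflection_def[abs_def])

lemma reflection_root: "\<alpha> \<in> \<Phi> \<Longrightarrow> \<beta> \<in> \<Phi> \<Longrightarrow> reflection \<alpha> \<beta> \<in> \<Phi>"
  using reflection_image by blast

lemma reflection_reflection: "\<alpha> \<in> \<Phi> \<Longrightarrow> reflection \<alpha> (reflection \<alpha> v) = v"
  by (simp add: reflection_def blinfun.diff_right blinfun.scaleR_right coroot_self scaleR_2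
      flip: scaleR_scaleR)

lemma reflection_self: "\<alpha> \<in> \<Phi> \<Longrightarrow> reflection \<alpha> \<alpha> = -\<alpha>"
  by (simp add: reflection_def coroot_self scaleR_2)

lemma reflection_uminus: "reflection \<alpha> (- v) = - reflection \<alpha> v"
  by (simp add: reflection_def blinfun.bilinear_simps)

lemma uminus_root: "\<alpha> \<in> \<Phi> \<Longrightarrow> -\<alpha> \<in> \<Phi>"
  using reflection_self reflection_root by metis

lemma pairing_dual_reflection: "\<langle>dual_reflection \<Phi> \<alpha> y, v\<rangle> = \<langle>y, reflection \<alpha> v\<rangle>"
  by (simp add: dual_reflection_def reflection_def blinfun.bilinear_simps)

lemma dual_reflection_dual_reflection:
  "\<alpha> \<in> \<Phi> \<Longrightarrow> dual_reflection \<Phi> \<alpha> (dual_reflection \<Phi> \<alpha> y) = y"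
  by (rule blinfun_eqI) (simp add: pairing_dual_reflection reflection_reflection)

lemma coroot_reflection:
  assumes \<alpha>: "\<alpha> \<in> \<Phi>" and \<beta>: "\<beta> \<in> \<Phi>"
  shows "coroot \<Phi> (reflection \<alpha> \<beta>) = dual_reflection \<Phi> \<alpha> (coroot \<Phi> \<beta>)"
proof (rule coroot_eqI[OF finite_roots span_roots])
  have *: "v - \<langle>coroot \<Phi> \<beta>, reflection \<alpha> v\<rangle> *\<^sub>R reflection \<alpha> \<beta> = reflection \<alpha> (reflection \<beta> (reflection \<alpha> v))" for v
  proof -
    have "reflection \<alpha> (reflection \<beta> (reflection \<alpha> v)) = reflection \<alpha> (reflection \<alpha> v) - \<langle>coroot \<Phi> \<beta>, reflection \<alpha> v\<rangle> *\<^sub>R reflection \<alpha> \<beta>"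
      unfolding reflection_def[of \<beta>]
      by (simp add: reflection_def[of \<alpha>] blinfun.bilinear_simps algebra_simps)
    then show ?thesis
      by (simp add: reflection_reflection[OF \<alpha>])
  qed
  have "(\<lambda>v. reflection \<alpha> (reflection \<beta> (reflection \<alpha> v))) ` \<Phi> =
      reflection \<alpha> ` reflection \<beta> ` reflection \<alpha> ` \<Phi>"
    by (simp add: image_image)
  then have "(\<lambda>v. reflection \<alpha> (reflection \<beta> (reflection \<alpha> v))) ` \<Phi> = \<Phi>"
    by (simp add: reflection_image \<alpha> \<beta>)
  then show "is_coroot \<Phi> (reflection \<alpha> \<beta>) (dual_reflection \<Phi> \<alpha> (coroot \<Phi> \<beta>))"
    by (simp add: is_coroot_def pairing_dual_reflection reflection_reflection[OF \<alpha>] coroot_self[OF \<beta>] *)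
qed

lemma reflection_conj:
  assumes "\<alpha> \<in> \<Phi>" "\<beta> \<in> \<Phi>"
  shows "reflection (reflection \<alpha> \<beta>) (reflection \<alpha> v) = reflection \<alpha> (reflection \<beta> v)"
proof -
  have "reflection (reflection \<alpha> \<beta>) (reflection \<alpha> v) = reflection \<alpha> v - \<langle>coroot \<Phi> \<beta>, v\<rangle> *\<^sub>R reflection \<alpha> \<beta>"
    by (simp add: reflection_def[of "reflection \<alpha> \<beta>"] coroot_reflection assms pairing_dual_reflection reflection_reflection)
  also have "\<dots> = reflection \<alpha> (reflection \<beta> v)"
    unfolding reflection_def[of \<beta>] by (simp add: reflection_def[of \<alpha>] blinfun.bilinear_simps algebra_simps)
  finally show ?thesis .
qed

lemma coroot_uminus:
  assumes "\<alpha> \<in> \<Phi>" shows "coroot \<Phi> (-\<alpha>) = - coroot \<Phi> \<alpha>"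
  using coroot_reflection[OF assms assms]
  by (simp add: reflection_self assms dual_reflection_def coroot_self scaleR_2)

lemma dual_reflection_uminus:
  "\<alpha> \<in> \<Phi> \<Longrightarrow> dual_reflection \<Phi> (-\<alpha>) = dual_reflection \<Phi> \<alpha>"
  by (rule ext) (simp add: dual_reflection_def coroot_uminus blinfun.bilinear_simps)

text \<open>
  A form on \<open>V\<^sup>*\<close> that is invariant because the reflections permute the roots, and positive definite
  because the roots span.
\<close>

definition form :: "('a \<Rightarrow>\<^sub>L real) \<Rightarrow> ('a \<Rightarrow>\<^sub>L real) \<Rightarrow> real" where
  "form y z = (\<Sum>\<beta>\<in>\<Phi>. \<langle>y, \<beta>\<rangle> * \<langle>z, \<beta>\<rangle>)"

lemma form_commute: "form y z = form z y"
  by (simp add: form_def mult.commute)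

lemma form_diff_left: "form (x - y) z = form x z - form y z"
  and form_scale_left: "form (c *\<^sub>R y) z = c * form y z"
  and form_diff_right: "form z (x - y) = form z x - form z y"
  and form_scale_right: "form z (c *\<^sub>R y) = c * form z y"
  by (simp_all add: form_def blinfun.bilinear_simps algebra_simps sum_subtractf sum_distrib_left)

lemma form_pos:
  assumes "y \<noteq> 0" shows "form y y > 0"
proof -
  obtain \<beta> where "\<beta> \<in> \<Phi>" "\<langle>y, \<beta>\<rangle> \<noteq> 0"
    using assms blinfun_eqI_span[OF span_roots, of y 0] by auto
  then show ?thesis
    unfolding form_def using finite_roots by (intro sum_pos2[of _ \<beta>]) (auto simp: zero_less_mult_iff)
qed

lemma form_dual_reflection:
  assumes "\<alpha> \<in> \<Phi>"
  shows "form (dual_reflection \<Phi> \<alpha> y) (dual_reflection \<Phi> \<alpha> z) = form y z"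
proof -
  have "inj_on (reflection \<alpha>) \<Phi>"
    by (rule inj_on_inverseI[of _ "reflection \<alpha>"]) (simp add: reflection_reflection assms)
  then have "form y z = (\<Sum>\<beta>\<in>\<Phi>. \<langle>y, reflection \<alpha> \<beta>\<rangle> * \<langle>z, reflection \<alpha> \<beta>\<rangle>)"
    unfolding form_def
    by (subst reflection_image[OF assms, symmetric], subst sum.reindex) (auto simp: o_def)
  then show ?thesis
    by (simp add: form_def pairing_dual_reflection)
qed

lemma form_coroot_pos: "\<alpha> \<in> \<Phi> \<Longrightarrow> form (coroot \<Phi> \<alpha>) (coroot \<Phi> \<alpha>) > 0"
  using coroot_self by (intro form_pos) force

lemma form_coroot:
  assumes "\<alpha> \<in> \<Phi>"
  shows "2 * form y (coroot \<Phi> \<alpha>) = \<langle>y, \<alpha>\<rangle> * form (coroot \<Phi> \<alpha>) (coroot \<Phi> \<alpha>)"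
proof -
  have "dual_reflection \<Phi> \<alpha> (coroot \<Phi> \<alpha>) = - coroot \<Phi> \<alpha>"
    by (simp add: dual_reflection_def coroot_self assms scaleR_2)
  then have "form y (coroot \<Phi> \<alpha>) = form (y - \<langle>y, \<alpha>\<rangle> *\<^sub>R coroot \<Phi> \<alpha>) ((-1) *\<^sub>R coroot \<Phi> \<alpha>)"
    using form_dual_reflection[OF assms, of y "coroot \<Phi> \<alpha>"] by (simp add: dual_reflection_def)
  then show ?thesis
    by (simp only: form_diff_left form_scale_left form_scale_right) (simp add: algebra_simps)
qed

section \<open>Positive roots and words in the simple reflections\<close>

lemma simple_subset: "\<Delta> \<subseteq> \<Phi>"
  and independent_simple: "independent \<Delta>"
  and span_simple: "span \<Delta> = UNIV"
  and root_sign: "\<beta> \<in> \<Phi> \<Longrightarrow> (\<forall>\<alpha>\<in>\<Delta>. coeff \<beta> \<alpha> \<in> \<nat>) \<or> (\<forall>\<alpha>\<in>\<Delta>. - coeff \<beta> \<alpha> \<in> \<nat>)"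
  using simple by (auto simp: simple_system_def)

lemma simple_root: "\<alpha> \<in> \<Delta> \<Longrightarrow> \<alpha> \<in> \<Phi>"
  using simple_subset by blast

lemma finite_simple: "finite \<Delta>"
  using finite_subset[OF simple_subset finite_roots] .

lemma coeff_uminus: "coeff (- v) \<alpha> = - coeff v \<alpha>"
  by (simp add: representation_neg independent_simple span_simple)

lemma coeff_diff: "coeff (v - w) \<alpha> = coeff v \<alpha> - coeff w \<alpha>"
  by (simp add: representation_diff independent_simple span_simple)

lemma coeff_add: "coeff (v + w) \<alpha> = coeff v \<alpha> + coeff w \<alpha>"
  by (simp add: representation_add independent_simple span_simple)

lemma coeff_scale: "coeff (c *\<^sub>R v) \<alpha> = c * coeff v \<alpha>"
  by (simp add: representation_scale independent_simple span_simple)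

lemma coeff_simple: "\<alpha> \<in> \<Delta> \<Longrightarrow> coeff \<alpha> \<gamma> = (if \<gamma> = \<alpha> then 1 else 0)"
  by (auto simp: representation_basis independent_simple)

lemma sum_coeff: "(\<Sum>\<alpha>\<in>\<Delta>. coeff v \<alpha> *\<^sub>R \<alpha>) = v"
  using sum_representation_eq[OF independent_simple, of v \<Delta>] span_simple finite_simple by simp

lemma pairing_expand: "\<langle>y, v\<rangle> = (\<Sum>\<alpha>\<in>\<Delta>. coeff v \<alpha> * \<langle>y, \<alpha>\<rangle>)"
  by (subst (1) sum_coeff[of v, symmetric]) (simp add: blinfun.sum_right blinfun.scaleR_right)

lemma coeff_integral: "\<beta> \<in> \<Phi> \<Longrightarrow> \<alpha> \<in> \<Delta> \<Longrightarrow> coeff \<beta> \<alpha> \<in> \<int>"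
  using root_sign[of \<beta>] Nats_subset_Ints by (metis Ints_minus add.inverse_inverse subsetD)

text \<open>Positive roots, with respect to the simple system.\<close>

definition positive :: "'a \<Rightarrow> bool" where
  "positive \<beta> \<longleftrightarrow> \<beta> \<in> \<Phi> \<and> (\<forall>\<alpha>\<in>\<Delta>. 0 \<le> coeff \<beta> \<alpha>)"

lemma positive_cases:
  assumes "\<beta> \<in> \<Phi>" obtains "positive \<beta>" | "positive (-\<beta>)"
proof -
  have "0 \<le> x" if "x \<in> \<nat>" for x :: real
    using that by (auto elim: Nats_cases)
  then show thesis
    using root_sign[OF assms] uminus_root[OF assms] assms that
    unfolding positive_def coeff_uminus by blast
qed

lemma not_positive_uminus:
  assumes "positive \<beta>" shows "\<not> positive (-\<beta>)"
proof
  assume "positive (-\<beta>)"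
  then have "coeff \<beta> \<alpha> = 0" if "\<alpha> \<in> \<Delta>" for \<alpha>
    using assms that by (force simp: positive_def coeff_uminus)
  then have "\<beta> = 0"
    using sum_coeff[of \<beta>] by simp
  then show False
    using assms zero_not_root by (simp add: positive_def)
qed

lemma simple_positive: "\<alpha> \<in> \<Delta> \<Longrightarrow> positive \<alpha>"
  by (simp add: positive_def simple_root coeff_simple)

text \<open>
  A simple reflection makes exactly one positive root negative. Reducedness is used here, to exclude
  the other positive multiples of \<open>\<alpha>\<close>.
\<close>

lemma positive_reflection:
  assumes \<beta>: "positive \<beta>" and \<alpha>: "\<alpha> \<in> \<Delta>" and ne: "\<beta> \<noteq> \<alpha>"
  shows "positive (reflection \<alpha> \<beta>)"
proof (rule ccontr)
  assume "\<not> positive (reflection \<alpha> \<beta>)"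
  moreover have "reflection \<alpha> \<beta> \<in> \<Phi>"
    using \<beta> \<alpha> simple_root by (simp add: reflection_root positive_def)
  ultimately have neg: "positive (- reflection \<alpha> \<beta>)"
    using positive_cases by blast
  have "coeff \<beta> \<gamma> = 0" if "\<gamma> \<in> \<Delta>" "\<gamma> \<noteq> \<alpha>" for \<gamma>
  proof -
    have "coeff (- reflection \<alpha> \<beta>) \<gamma> = - coeff \<beta> \<gamma>"
      unfolding reflection_def coeff_uminus coeff_diff coeff_scale by (simp add: coeff_simple \<alpha> that)
    then show ?thesis
      using neg \<beta> that unfolding positive_def by (metis antisym neg_0_le_iff_le)
  qed
  then have "(\<Sum>\<gamma>\<in>\<Delta>. coeff \<beta> \<gamma> *\<^sub>R \<gamma>) = coeff \<beta> \<alpha> *\<^sub>R \<alpha>"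
    using \<alpha> finite_simple by (subst sum.remove[of _ \<alpha>]) auto
  then have eq: "\<beta> = coeff \<beta> \<alpha> *\<^sub>R \<alpha>"
    by (simp add: sum_coeff)
  then have "coeff \<beta> \<alpha> = 1 \<or> coeff \<beta> \<alpha> = -1"
    using reduced \<beta> simple_root[OF \<alpha>] unfolding reduced_roots_def positive_def by metis
  moreover have "coeff \<beta> \<alpha> \<noteq> -1"
    using \<beta> \<alpha> unfolding positive_def by force
  ultimately show False
    using eq ne by simp
qed

text \<open>
  A word in the roots acts on \<open>V\<close> and, through the transposed maps (hence in the reverse order),
  on \<open>V\<^sup>*\<close>.
\<close>

primrec word :: "'a list \<Rightarrow> 'a \<Rightarrow> 'a" where
  "word [] v = v"
| "word (\<alpha> # as) v = reflection \<alpha> (word as v)"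

primrec dual_word :: "'a list \<Rightarrow> ('a \<Rightarrow>\<^sub>L real) \<Rightarrow> ('a \<Rightarrow>\<^sub>L real)" where
  "dual_word [] y = y"
| "dual_word (\<alpha> # as) y = dual_word as (dual_reflection \<Phi> \<alpha> y)"

lemma pairing_dual_word: "\<langle>dual_word as y, v\<rangle> = \<langle>y, word as v\<rangle>"
  by (induction as arbitrary: y) (simp_all add: pairing_dual_reflection)

lemma word_append: "word (as @ bs) v = word as (word bs v)"
  by (induction as) simp_all

lemma dual_word_append: "dual_word (as @ bs) y = dual_word bs (dual_word as y)"
  by (induction as arbitrary: y) simp_all

lemma word_uminus: "word as (- v) = - word as v"
  by (induction as) (simp_all add: reflection_uminus)

lemma word_root: "set as \<subseteq> \<Phi> \<Longrightarrow> \<beta> \<in> \<Phi> \<Longrightarrow> word as \<beta> \<in> \<Phi>"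
  by (induction as) (auto simp: reflection_root)

lemma word_rev: "set as \<subseteq> \<Phi> \<Longrightarrow> word (rev as) (word as v) = v"
  by (induction as arbitrary: v) (auto simp: word_append reflection_reflection)

lemma dual_word_rev: "set as \<subseteq> \<Phi> \<Longrightarrow> dual_word (rev as) (dual_word as y) = y"
  using word_rev[of "rev as"] by (intro blinfun_eqI) (simp add: pairing_dual_word)

lemma dual_word_add: "dual_word as (y + z) = dual_word as y + dual_word as z"
  and dual_word_diff: "dual_word as (y - z) = dual_word as y - dual_word as z"
  by (rule blinfun_eqI; simp add: pairing_dual_word blinfun.bilinear_simps)+

lemma dual_word_eqI: "(\<And>v. word as v = word bs v) \<Longrightarrow> dual_word as = dual_word bs"
  by (rule ext, rule blinfun_eqI) (simp add: pairing_dual_word)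

lemma continuous_dual_word: "continuous_on UNIV (dual_word as)"
proof (induction as)
  case (Cons \<alpha> as)
  have "continuous_on UNIV (dual_reflection \<Phi> \<alpha>)"
    unfolding dual_reflection_def[abs_def] by (intro continuous_intros)
  then show ?case
    using continuous_on_compose2[OF Cons, of UNIV "dual_reflection \<Phi> \<alpha>"] by simp
qed simp

lemma word_conj:
  "set as \<subseteq> \<Phi> \<Longrightarrow> \<alpha> \<in> \<Phi> \<Longrightarrow> reflection (word as \<alpha>) (word as v) = word as (reflection \<alpha> v)"
  by (induction as) (auto simp: reflection_conj word_root)

text \<open>
  The exchange condition: if a word in the simple reflections makes the simple root \<open>\<alpha>\<close> negative,
  appending \<open>\<alpha>\<close> has the effect of deleting a letter. Reading from the right, the deleted letter is
  the first one at which the image of \<open>\<alpha>\<close> changes sign; there this image equals the letter itself.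
\<close>

lemma word_exchange:
  assumes "set as \<subseteq> \<Delta>" "\<alpha> \<in> \<Delta>" "positive (- word as \<alpha>)"
  shows "\<exists>bs. set bs \<subseteq> \<Delta> \<and> length bs < length as \<and> (\<forall>v. word bs v = word (as @ [\<alpha>]) v)"
  using assms
proof (induction as)
  case Nil
  then have "coeff (- \<alpha>) \<alpha> \<ge> 0"
    by (simp add: positive_def)
  then show ?case
    using Nil by (simp add: coeff_uminus coeff_simple)
next
  case (Cons \<gamma> as)
  have sub: "set as \<subseteq> \<Phi>" "\<alpha> \<in> \<Phi>" "\<gamma> \<in> \<Delta>" "\<gamma> \<in> \<Phi>"
    using Cons.prems simple_root by auto
  show ?case
  proof (cases "positive (- word as \<alpha>)")
    case True
    then obtain bs where "set bs \<subseteq> \<Delta>" "length bs < length as" "\<forall>v. word bs v = word (as @ [\<alpha>]) v"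
      using Cons by auto
    then show ?thesis
      using sub by (intro exI[of _ "\<gamma> # bs"]) auto
  next
    case False
    then have pos: "positive (word as \<alpha>)"
      using positive_cases[OF word_root[OF sub(1,2)]] by blast
    have "\<not> positive (reflection \<gamma> (word as \<alpha>))"
      using Cons.prems(3) not_positive_uminus by auto
    then have eq: "word as \<alpha> = \<gamma>"
      using positive_reflection[OF pos sub(3)] by blast
    have "word as v = word ((\<gamma> # as) @ [\<alpha>]) v" for v
      using word_conj[OF sub(1,2), of v] reflection_reflection[OF sub(4)] by (simp add: word_append eq) metis
    then show ?thesis
      using Cons.prems by (intro exI[of _ as]) auto
  qed
qed

text \<open>Membership in the closed dominant chamber of \<open>V\<^sup>*\<close>.\<close>

definition dominant :: "('a \<Rightarrow>\<^sub>L real) \<Rightarrow> bool" where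
  "dominant y \<longleftrightarrow> (\<forall>\<alpha>\<in>\<Delta>. 0 \<le> \<langle>y, \<alpha>\<rangle>)"

lemma dominant_pairing_mono:
  assumes "dominant y" "\<And>\<alpha>. \<alpha> \<in> \<Delta> \<Longrightarrow> coeff u \<alpha> \<le> coeff v \<alpha>"
  shows "\<langle>y, u\<rangle> \<le> \<langle>y, v\<rangle>"
  unfolding pairing_expand[of y u] pairing_expand[of y v]
  using assms by (intro sum_mono mult_right_mono) (auto simp: dominant_def)

lemma ex_fundamental_coweight: "\<exists>\<omega>. \<forall>v. \<langle>\<omega>, v\<rangle> = coeff v \<alpha>"
  by (rule ex_blinfun_eq) (auto intro: linearI simp: coeff_add coeff_scale)

lemma ex_height: "\<exists>h. \<forall>\<alpha>\<in>\<Delta>. \<langle>h, \<alpha>\<rangle> = 1"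
proof -
  have "linear (\<lambda>v. \<Sum>\<alpha>\<in>\<Delta>. coeff v \<alpha>)"
    by (rule linearI) (simp_all add: coeff_add coeff_scale sum.distrib sum_distrib_left)
  then obtain h where "\<And>v. \<langle>h, v\<rangle> = (\<Sum>\<alpha>\<in>\<Delta>. coeff v \<alpha>)"
    using ex_blinfun_eq by blast
  then show ?thesis
    using finite_simple by (intro exI[of _ h]) (simp add: coeff_simple)
qed

text \<open>
  A point of the orbit that is highest in the direction of a strictly dominant functional is
  dominant.
\<close>

lemma ex_dominant: "\<exists>as. set as \<subseteq> \<Delta> \<and> dominant (dual_word as y)"
proof -
  define X where "X = {dual_word as y | as. set as \<subseteq> \<Delta>}"
  obtain h where h: "\<And>\<alpha>. \<alpha> \<in> \<Delta> \<Longrightarrow> \<langle>h, \<alpha>\<rangle> = 1"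
    using ex_height by blast
  have "X \<subseteq> {z. \<forall>\<beta>\<in>\<Phi>. \<langle>z, \<beta>\<rangle> \<in> (\<lambda>\<gamma>. \<langle>y, \<gamma>\<rangle>) ` \<Phi>}"
    using word_root simple_subset by (auto simp: X_def pairing_dual_word)
  then have fin: "finite ((\<lambda>z. form z h) ` X)"
    using finite_blinfuns_with_finite_values[OF finite_roots span_roots] finite_roots
    by (meson finite_imageI finite_subset)
  have "dual_word [] y \<in> X"
    unfolding X_def by (intro CollectI exI[of _ "[]"]) auto
  then obtain z where "z \<in> X" and z: "form z h = Max ((\<lambda>z. form z h) ` X)"
    using Max_in[OF fin] by (metis (no_types, lifting) empty_iff imageE image_is_empty)
  then obtain as where as: "set as \<subseteq> \<Delta>" "z = dual_word as y"
    by (auto simp: X_def)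
  have "0 \<le> \<langle>z, \<alpha>\<rangle>" if \<alpha>: "\<alpha> \<in> \<Delta>" for \<alpha>
  proof (rule ccontr)
    assume neg: "\<not> 0 \<le> \<langle>z, \<alpha>\<rangle>"
    have "dual_reflection \<Phi> \<alpha> z = dual_word (as @ [\<alpha>]) y"
      by (simp add: dual_word_append as)
    then have "dual_reflection \<Phi> \<alpha> z \<in> X"
      unfolding X_def using as(1) \<alpha> by (intro CollectI exI[of _ "as @ [\<alpha>]"]) auto
    then have "form (dual_reflection \<Phi> \<alpha> z) h \<le> form z h"
      unfolding z using fin by simp
    then have "0 \<le> \<langle>z, \<alpha>\<rangle> * form h (coroot \<Phi> \<alpha>)"
      by (simp add: dual_reflection_def form_diff_left form_scale_left
          form_commute[of "coroot \<Phi> \<alpha>" h])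
    moreover have "form h (coroot \<Phi> \<alpha>) > 0"
      using form_coroot[of \<alpha> h] form_coroot_pos[of \<alpha>] simple_root[OF \<alpha>] h[OF \<alpha>] by simp
    ultimately show False
      using neg by (simp add: zero_le_mult_iff)
  qed
  then show ?thesis
    using as by (auto simp: dominant_def)
qed

text \<open>
  Simple transitivity on chambers: if \<^term>\<open>as\<close> is a shortest word for its element and ends
  in \<open>\<alpha>\<close>, then by the exchange condition the element sends \<open>\<alpha>\<close> to a negative root, so that the
  dual element sends strictly dominant points to points that are negative on \<open>\<alpha>\<close>.
\<close>

lemma dual_word_trivial:
  assumes "set as \<subseteq> \<Delta>" and pos: "\<And>\<alpha>. \<alpha> \<in> \<Delta> \<Longrightarrow> 0 < \<langle>y, \<alpha>\<rangle>"
    and "dominant (dual_word as y)"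
  shows "dual_word as = (\<lambda>z. z)"
  using assms(1,3)
proof (induction "length as" arbitrary: as rule: less_induct)
  case less
  show ?case
  proof (cases as rule: rev_cases)
    case Nil
    then show ?thesis
      by (simp add: fun_eq_iff)
  next
    case (snoc cs \<alpha>)
    then have cs: "set cs \<subseteq> \<Delta>" "set cs \<subseteq> \<Phi>" and \<alpha>: "\<alpha> \<in> \<Delta>" "\<alpha> \<in> \<Phi>"
      using less.prems(1) simple_root by auto
    show ?thesis
    proof (cases rule: positive_cases[OF word_root[OF cs(2) \<alpha>(2)]])
      case 1
      have "\<langle>dual_word as y, \<alpha>\<rangle> = - \<langle>y, word cs \<alpha>\<rangle>"
        by (simp add: snoc pairing_dual_word word_append reflection_self \<alpha> word_uminus
            blinfun.minus_right)
      moreover have "0 < \<langle>y, word cs \<alpha>\<rangle>"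
      proof -
        have "word cs \<alpha> \<noteq> 0"
          using 1 zero_not_root by (auto simp: positive_def)
        then obtain \<gamma> where \<gamma>: "\<gamma> \<in> \<Delta>" "coeff (word cs \<alpha>) \<gamma> \<noteq> 0"
          using sum_coeff[of "word cs \<alpha>"] by (metis (no_types, lifting) scaleR_zero_left sum.neutral)
        then have "0 < coeff (word cs \<alpha>) \<gamma> * \<langle>y, \<gamma>\<rangle>"
          using 1 pos by (force simp: positive_def less_le)
        moreover have "0 \<le> coeff (word cs \<alpha>) \<delta> * \<langle>y, \<delta>\<rangle>" if "\<delta> \<in> \<Delta>" for \<delta>
          using 1 pos that by (simp add: positive_def less_imp_le)
        ultimately show ?thesis
          unfolding pairing_expand[of y "word cs \<alpha>"] using finite_simple \<gamma>
          by (intro sum_pos2[of _ \<gamma>]) auto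
      qed
      ultimately show ?thesis
        using less.prems(2) \<alpha> by (force simp: dominant_def)
    next
      case 2
      then obtain bs where bs: "set bs \<subseteq> \<Delta>" "length bs < length cs"
          "\<And>v. word bs v = word as v"
        using word_exchange[OF cs(1) \<alpha>(1)] snoc by auto
      then have "dual_word bs = dual_word as"
        by (intro dual_word_eqI)
      then show ?thesis
        using less.hyps[of bs] less.prems bs snoc by simp
    qed
  qed
qed

text \<open>
  A root of least height among the positive roots of its orbit is simple: otherwise no simple reflection lowers its
  height, so that its coroot is non-positive on every simple root and hence on the root itself.
\<close>

lemma positive_root_conj_simple:
  assumes \<beta>: "positive \<beta>"
  shows "\<exists>as. set as \<subseteq> \<Delta> \<and> word as \<beta> \<in> \<Delta>"
proof -
  define X where "X = {\<gamma>. positive \<gamma> \<and> (\<exists>as. set as \<subseteq> \<Delta> \<and> \<gamma> = word as \<beta>)}"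
  obtain h where h: "\<And>\<alpha>. \<alpha> \<in> \<Delta> \<Longrightarrow> \<langle>h, \<alpha>\<rangle> = 1"
    using ex_height by blast
  have "X \<subseteq> \<Phi>"
    by (auto simp: X_def positive_def)
  then have fin: "finite ((\<lambda>\<gamma>. \<langle>h, \<gamma>\<rangle>) ` X)"
    using finite_roots by (meson finite_imageI finite_subset)
  have "word [] \<beta> \<in> X"
    unfolding X_def using \<beta> by (auto intro: exI[of _ "[]"])
  then obtain \<gamma> where \<gamma>: "\<gamma> \<in> X" and min: "\<langle>h, \<gamma>\<rangle> = Min ((\<lambda>\<gamma>. \<langle>h, \<gamma>\<rangle>) ` X)"
    using Min_in[OF fin] by (metis (no_types, lifting) empty_iff imageE image_is_empty)
  then obtain as where as: "set as \<subseteq> \<Delta>" "\<gamma> = word as \<beta>" and pos: "positive \<gamma>"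
    by (auto simp: X_def)
  have \<gamma>_root: "\<gamma> \<in> \<Phi>"
    using pos by (simp add: positive_def)
  have "\<gamma> \<in> \<Delta>"
  proof (rule ccontr)
    assume "\<gamma> \<notin> \<Delta>"
    \<comment> \<open>Minimality bounds the coroot of \<open>\<alpha>\<close> at \<open>\<gamma>\<close>; by symmetry of the form, the coroot of \<open>\<gamma>\<close> at
      \<open>\<alpha>\<close> has the same sign.\<close>
    have "\<langle>coroot \<Phi> \<gamma>, \<alpha>\<rangle> \<le> 0" if \<alpha>: "\<alpha> \<in> \<Delta>" for \<alpha>
    proof -
      have "reflection \<alpha> \<gamma> = word (\<alpha> # as) \<beta>"
        by (simp add: as)
      moreover have "positive (reflection \<alpha> \<gamma>)"
        using positive_reflection[OF pos \<alpha>] \<alpha> \<open>\<gamma> \<notin> \<Delta>\<close> by blast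
      ultimately have "reflection \<alpha> \<gamma> \<in> X"
        unfolding X_def using as(1) \<alpha> by (intro CollectI conjI exI[of _ "\<alpha> # as"]) auto
      then have "\<langle>h, \<gamma>\<rangle> \<le> \<langle>h, reflection \<alpha> \<gamma>\<rangle>"
        unfolding min using fin by simp
      then have "\<langle>coroot \<Phi> \<alpha>, \<gamma>\<rangle> \<le> 0"
        by (simp add: reflection_def blinfun.bilinear_simps h \<alpha>)
      moreover have "\<langle>coroot \<Phi> \<gamma>, \<alpha>\<rangle> * form (coroot \<Phi> \<alpha>) (coroot \<Phi> \<alpha>) =
          \<langle>coroot \<Phi> \<alpha>, \<gamma>\<rangle> * form (coroot \<Phi> \<gamma>) (coroot \<Phi> \<gamma>)"
        using form_coroot[OF simple_root[OF \<alpha>], of "coroot \<Phi> \<gamma>"]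
          form_coroot[OF \<gamma>_root, of "coroot \<Phi> \<alpha>"] by (simp add: form_commute)
      ultimately have "\<langle>coroot \<Phi> \<gamma>, \<alpha>\<rangle> * form (coroot \<Phi> \<alpha>) (coroot \<Phi> \<alpha>) \<le> 0"
        using form_coroot_pos[OF \<gamma>_root] by (simp add: mult_le_0_iff)
      then show ?thesis
        using form_coroot_pos[OF simple_root[OF \<alpha>]] by (simp add: mult_le_0_iff)
    qed
    then have "\<langle>coroot \<Phi> \<gamma>, \<gamma>\<rangle> \<le> 0"
      unfolding pairing_expand[of _ \<gamma>] using pos
      by (intro sum_nonpos mult_nonneg_nonpos) (auto simp: positive_def)
    then show False
      using coroot_self[OF \<gamma>_root] by simp
  qed
  then show ?thesis
    using as by blast
qed

lemma dual_reflection_eq_word: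
  assumes "\<beta> \<in> \<Phi>"
  shows "\<exists>as. set as \<subseteq> \<Delta> \<and> dual_reflection \<Phi> \<beta> = dual_word as"
proof -
  have *: "\<exists>as. set as \<subseteq> \<Delta> \<and> dual_reflection \<Phi> \<beta> = dual_word as" if pos: "positive \<beta>" for \<beta>
  proof -
    obtain as where as: "set as \<subseteq> \<Delta>" "word as \<beta> \<in> \<Delta>"
      using positive_root_conj_simple[OF pos] by blast
    have root: "\<beta> \<in> \<Phi>" "set as \<subseteq> \<Phi>"
      using pos as(1) simple_subset by (auto simp: positive_def)
    let ?bs = "rev as @ word as \<beta> # as"
    have "word [\<beta>] v = word ?bs v" for v
      using word_conj[OF root(2,1), of v] word_rev[OF root(2), of "reflection \<beta> v"]
      by (simp add: word_append)
    then have "dual_word [\<beta>] = dual_word ?bs"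
      by (rule dual_word_eqI)
    then have "dual_reflection \<Phi> \<beta> = dual_word ?bs"
      by (simp add: fun_eq_iff)
    then show ?thesis
      using as by (intro exI[of _ ?bs]) auto
  qed
  show ?thesis
    using positive_cases[OF assms] *[of \<beta>] *[of "-\<beta>"] dual_reflection_uminus[OF assms] by metis
qed

section \<open>The extended affine Weyl group\<close>

lemma bij_dual_word: "set as \<subseteq> \<Phi> \<Longrightarrow> bij (dual_word as)"
  using dual_word_rev[of as] dual_word_rev[of "rev as"]
  by (intro o_bij[of "dual_word (rev as)"]) auto

lemma weyl_group_eq: "weyl_group \<Phi> = {dual_word as | as. set as \<subseteq> \<Delta>}"
proof (intro subset_antisym subsetI)
  fix w assume "w \<in> weyl_group \<Phi>"
  then have "w \<in> generate (BijGroup UNIV) (dual_reflection \<Phi> ` \<Phi>)"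
    by (simp add: weyl_group_def)
  then show "w \<in> {dual_word as | as. set as \<subseteq> \<Delta>}"
  proof induction
    case one
    have "\<one>\<^bsub>BijGroup UNIV\<^esub> = dual_word []"
      by (simp add: one_BijGroup fun_eq_iff)
    then show ?case
      by (intro CollectI exI[of _ "[]"]) simp
  next
    case (incl w)
    then show ?case
      using dual_reflection_eq_word by blast
  next
    case (inv w)
    then have "inv\<^bsub>BijGroup UNIV\<^esub> w = w"
      by (auto intro!: inv_BijGroup simp: dual_reflection_dual_reflection)
    then show ?case
      using inv dual_reflection_eq_word by auto
  next
    case (eng w w')
    then obtain as bs where *: "set as \<subseteq> \<Delta>" "w = dual_word as" "set bs \<subseteq> \<Delta>" "w' = dual_word bs"
      by auto
    then have "bij w" "bij w'"
      using simple_subset by (auto intro!: bij_dual_word)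
    then have "w \<otimes>\<^bsub>BijGroup UNIV\<^esub> w' = dual_word (bs @ as)"
      by (simp add: mult_BijGroup dual_word_append fun_eq_iff *)
    then show ?case
      using * by (intro CollectI exI[of _ "bs @ as"]) simp
  qed
next
  fix w assume "w \<in> {dual_word as | as. set as \<subseteq> \<Delta>}"
  then obtain as where "set as \<subseteq> \<Delta>" "w = dual_word as"
    by blast
  moreover have "dual_word as \<in> weyl_group \<Phi>" if "set as \<subseteq> \<Delta>" for as
    using that
  proof (induction as)
    case Nil
    have "dual_word [] = \<one>\<^bsub>BijGroup UNIV\<^esub>"
      by (simp add: one_BijGroup fun_eq_iff)
    then show ?case
      by (simp add: weyl_group_def generate.one)
  next
    case (Cons \<alpha> as)
    then have \<alpha>: "\<alpha> \<in> \<Phi>" and as: "set as \<subseteq> \<Phi>"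
      using simple_subset by auto
    have "bij (dual_reflection \<Phi> \<alpha>)"
      by (rule o_bij[of "dual_reflection \<Phi> \<alpha>"]) (auto simp: dual_reflection_dual_reflection \<alpha>)
    then have "dual_word (\<alpha> # as) = dual_word as \<otimes>\<^bsub>BijGroup UNIV\<^esub> dual_reflection \<Phi> \<alpha>"
      using as by (simp add: mult_BijGroup bij_dual_word fun_eq_iff)
    then show ?case
      using Cons \<alpha> unfolding weyl_group_def by (auto intro: generate.eng generate.incl)
  qed
  ultimately show "w \<in> weyl_group \<Phi>"
    by blast
qed

lemma coweight_lattice_uminus: "l \<in> coweight_lattice \<Phi> \<Longrightarrow> - l \<in> coweight_lattice \<Phi>"
  and coweight_lattice_add:
    "l \<in> coweight_lattice \<Phi> \<Longrightarrow> m \<in> coweight_lattice \<Phi> \<Longrightarrow> l + m \<in> coweight_lattice \<Phi>"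
  and coweight_lattice_zero: "0 \<in> coweight_lattice \<Phi>"
  by (auto simp: coweight_lattice_def blinfun.bilinear_simps)

lemma coweight_lattice_dual_word:
  "set as \<subseteq> \<Phi> \<Longrightarrow> l \<in> coweight_lattice \<Phi> \<Longrightarrow> dual_word as l \<in> coweight_lattice \<Phi>"
  by (auto simp: coweight_lattice_def pairing_dual_word word_root)

text \<open>The element acting as \<^term>\<open>dual_word as\<close> followed by translation by \<open>l\<close>.\<close>

definition affine_word :: "'a list \<Rightarrow> ('a \<Rightarrow>\<^sub>L real) \<Rightarrow> ('a \<Rightarrow>\<^sub>L real) \<Rightarrow> ('a \<Rightarrow>\<^sub>L real)" where
  "affine_word as l y = dual_word as y + l"

lemma affine_word_inverse:
  assumes "set as \<subseteq> \<Phi>"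
  shows "affine_word (rev as) (- dual_word (rev as) l) (affine_word as l y) = y"
    and "affine_word as l (affine_word (rev as) (- dual_word (rev as) l) y) = y"
  using dual_word_rev[OF assms] dual_word_rev[of "rev as"] assms
  by (simp_all add: affine_word_def dual_word_add dual_word_diff)

lemma bij_affine_word: "set as \<subseteq> \<Phi> \<Longrightarrow> bij (affine_word as l)"
  using affine_word_inverse[of as l]
  by (intro o_bij[of "affine_word (rev as) (- dual_word (rev as) l)"]) auto

lemma carrier_extended_affine_weyl_group:
  "carrier (extended_affine_weyl_group \<Phi>) =
     {affine_word as l | as l. set as \<subseteq> \<Delta> \<and> l \<in> coweight_lattice \<Phi>}"
proof -
  have *: "(\<lambda>x. x + l) \<otimes>\<^bsub>BijGroup UNIV\<^esub> dual_word as = affine_word as l"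
    if "set as \<subseteq> \<Delta>" for l as
  proof -
    have "bij (\<lambda>x. x + l)"
      by (rule o_bij[of "\<lambda>x. x - l"]) auto
    then show ?thesis
      using that simple_subset by (simp add: mult_BijGroup bij_dual_word fun_eq_iff affine_word_def)
  qed
  show ?thesis
  proof (intro subset_antisym subsetI)
    fix w assume "w \<in> carrier (extended_affine_weyl_group \<Phi>)"
    then obtain l as where "l \<in> coweight_lattice \<Phi>" "set as \<subseteq> \<Delta>"
        "w = (\<lambda>x. x + l) \<otimes>\<^bsub>BijGroup UNIV\<^esub> dual_word as"
      by (auto simp: extended_affine_weyl_group_def set_mult_def translation_group_def weyl_group_eq)
    then show "w \<in> {affine_word as l | as l. set as \<subseteq> \<Delta> \<and> l \<in> coweight_lattice \<Phi>}"
      using * by blast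
  next
    fix w assume "w \<in> {affine_word as l | as l. set as \<subseteq> \<Delta> \<and> l \<in> coweight_lattice \<Phi>}"
    then obtain l as where "l \<in> coweight_lattice \<Phi>" "set as \<subseteq> \<Delta>" "w = affine_word as l"
      by blast
    then show "w \<in> carrier (extended_affine_weyl_group \<Phi>)"
      using *[of as l]
      by (force simp: extended_affine_weyl_group_def set_mult_def translation_group_def weyl_group_eq)
  qed
qed

lemma one_extended_affine_weyl_group: "\<one>\<^bsub>extended_affine_weyl_group \<Phi>\<^esub> = (\<lambda>x. x)"
  by (simp add: extended_affine_weyl_group_def one_BijGroup)

lemma subgroup_extended_affine_weyl_group:
  "subgroup (carrier (extended_affine_weyl_group \<Phi>)) (BijGroup UNIV)"
proof (rule group.subgroupI[OF group_BijGroup])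
  show "carrier (extended_affine_weyl_group \<Phi>) \<subseteq> carrier (BijGroup UNIV)"
    using bij_affine_word simple_subset
    by (auto simp: carrier_extended_affine_weyl_group carrier_BijGroup)
  have "affine_word [] 0 \<in> carrier (extended_affine_weyl_group \<Phi>)"
    unfolding carrier_extended_affine_weyl_group using coweight_lattice_zero
    by (intro CollectI exI[of _ "[]"] exI[of _ 0]) simp
  then show "carrier (extended_affine_weyl_group \<Phi>) \<noteq> {}"
    by blast
next
  fix w assume "w \<in> carrier (extended_affine_weyl_group \<Phi>)"
  then obtain as l where *: "set as \<subseteq> \<Delta>" "l \<in> coweight_lattice \<Phi>" "w = affine_word as l"
    by (auto simp: carrier_extended_affine_weyl_group)
  have root: "set as \<subseteq> \<Phi>"
    using * simple_subset by blast
  have "inv\<^bsub>BijGroup UNIV\<^esub> w = affine_word (rev as) (- dual_word (rev as) l)"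
    unfolding *(3) by (rule inv_BijGroup) (simp_all add: affine_word_inverse root)
  moreover have "- dual_word (rev as) l \<in> coweight_lattice \<Phi>"
    using * root by (simp add: coweight_lattice_uminus coweight_lattice_dual_word)
  ultimately show "inv\<^bsub>BijGroup UNIV\<^esub> w \<in> carrier (extended_affine_weyl_group \<Phi>)"
    unfolding carrier_extended_affine_weyl_group using *
    by (intro CollectI exI[of _ "rev as"] exI[of _ "- dual_word (rev as) l"]) simp
next
  fix w w' assume "w \<in> carrier (extended_affine_weyl_group \<Phi>)"
    and "w' \<in> carrier (extended_affine_weyl_group \<Phi>)"
  then obtain as l bs m where *: "set as \<subseteq> \<Delta>" "l \<in> coweight_lattice \<Phi>" "w = affine_word as l"
      "set bs \<subseteq> \<Delta>" "m \<in> coweight_lattice \<Phi>" "w' = affine_word bs m"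
    by (auto simp: carrier_extended_affine_weyl_group)
  have root: "set as \<subseteq> \<Phi>" "set bs \<subseteq> \<Phi>"
    using * simple_subset by auto
  have "w \<otimes>\<^bsub>BijGroup UNIV\<^esub> w' = affine_word (bs @ as) (dual_word as m + l)"
    by (simp add: * root mult_BijGroup bij_affine_word affine_word_def fun_eq_iff
        dual_word_add dual_word_append add.assoc)
  moreover have "dual_word as m + l \<in> coweight_lattice \<Phi>"
    using * root by (simp add: coweight_lattice_add coweight_lattice_dual_word)
  ultimately show "w \<otimes>\<^bsub>BijGroup UNIV\<^esub> w' \<in> carrier (extended_affine_weyl_group \<Phi>)"
    unfolding carrier_extended_affine_weyl_group using *
    by (intro CollectI exI[of _ "bs @ as"] exI[of _ "dual_word as m + l"]) simp
qed

lemma group_action_extended_affine_weyl_group: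
  "group_action (extended_affine_weyl_group \<Phi>) UNIV (\<lambda>w. w)"
proof -
  let ?E = "extended_affine_weyl_group \<Phi>"
  have eq: "?E = (BijGroup UNIV)\<lparr>carrier := carrier ?E\<rparr>"
    by (simp add: extended_affine_weyl_group_def)
  then have "group ?E"
    using group.subgroup_imp_group[OF group_BijGroup subgroup_extended_affine_weyl_group] by simp
  moreover have "(\<lambda>w. w) \<in> hom ?E (BijGroup UNIV)"
    using subgroup.subset[OF subgroup_extended_affine_weyl_group] eq
    by (auto simp: hom_def extended_affine_weyl_group_def)
  ultimately show ?thesis
    by (simp add: group_action_def group_hom_def group_hom_axioms_def group_BijGroup)
qed

lemma continuous_affine_word: "continuous_on UNIV (affine_word as l)"
  unfolding affine_word_def[abs_def] by (intro continuous_intros continuous_dual_word)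

end

section \<open>The root gauge\<close>

locale highest_root_system = based_root_system +
  fixes \<alpha>\<^sub>0 :: 'a
  assumes highest: "highest_root \<Phi> \<Delta> \<alpha>\<^sub>0"
begin

lemma highest_root: "\<alpha>\<^sub>0 \<in> \<Phi>"
  and coeff_le_highest: "\<beta> \<in> \<Phi> \<Longrightarrow> \<alpha> \<in> \<Delta> \<Longrightarrow> coeff \<beta> \<alpha> \<le> coeff \<alpha>\<^sub>0 \<alpha>"
  using highest by (auto simp: highest_root_def)

lemma highest_coeff_ge_1: "\<alpha> \<in> \<Delta> \<Longrightarrow> 1 \<le> coeff \<alpha>\<^sub>0 \<alpha>"
  using coeff_le_highest[of \<alpha> \<alpha>] by (simp add: simple_root coeff_simple)

lemma dominant_pairing_le_highest:
  "dominant y \<Longrightarrow> \<beta> \<in> \<Phi> \<Longrightarrow> \<langle>y, \<beta>\<rangle> \<le> \<langle>y, \<alpha>\<^sub>0\<rangle>"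
  by (rule dominant_pairing_mono) (auto simp: coeff_le_highest)

text \<open>
  The norm on \<open>V\<^sup>*\<close> whose unit ball is the polar of the set of roots. It is invariant under the Weyl
  group and is given by the highest root on the dominant chamber.
\<close>

definition gauge :: "('a \<Rightarrow>\<^sub>L real) \<Rightarrow> real" where
  "gauge y = Max ((\<lambda>\<beta>. \<langle>y, \<beta>\<rangle>) ` \<Phi>)"

lemma gauge_ge: "\<beta> \<in> \<Phi> \<Longrightarrow> \<langle>y, \<beta>\<rangle> \<le> gauge y"
  unfolding gauge_def using finite_roots by simp

lemma gauge_le: "(\<And>\<beta>. \<beta> \<in> \<Phi> \<Longrightarrow> \<langle>y, \<beta>\<rangle> \<le> c) \<Longrightarrow> gauge y \<le> c"
  unfolding gauge_def using finite_roots highest_root by (subst Max_le_iff) auto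

lemma abs_pairing_le_gauge: "\<beta> \<in> \<Phi> \<Longrightarrow> \<bar>\<langle>y, \<beta>\<rangle>\<bar> \<le> gauge y"
  using gauge_ge[of \<beta> y] gauge_ge[OF uminus_root, of \<beta> y] by (simp add: blinfun.minus_right)

lemma gauge_dual_word:
  assumes "set as \<subseteq> \<Phi>" shows "gauge (dual_word as y) = gauge y"
proof (rule antisym)
  have *: "gauge (dual_word bs z) \<le> gauge z" if "set bs \<subseteq> \<Phi>" for bs z
    by (rule gauge_le) (simp add: pairing_dual_word gauge_ge word_root that)
  show "gauge (dual_word as y) \<le> gauge y"
    using *[OF assms] .
  show "gauge y \<le> gauge (dual_word as y)"
    using *[of "rev as" "dual_word as y"] assms by (simp add: dual_word_rev)
qed

lemma form_dual_word:
  "set as \<subseteq> \<Phi> \<Longrightarrow> form (dual_word as y) (dual_word as z) = form y z"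
  by (induction as arbitrary: y z) (auto simp: form_dual_reflection)

lemma gauge_dominant: "dominant y \<Longrightarrow> gauge y = \<langle>y, \<alpha>\<^sub>0\<rangle>"
  by (intro antisym gauge_le dominant_pairing_le_highest gauge_ge highest_root)

section \<open>The polytope\<close>

abbreviation F :: "('a \<Rightarrow>\<^sub>L real) set" where
  "F \<equiv> coweight_polytope \<Delta> \<alpha>\<^sub>0"

lemma F_iff:
  "y \<in> F \<longleftrightarrow> dominant y \<and> \<langle>y, \<alpha>\<^sub>0\<rangle> \<le> 1 \<and>
     (\<forall>\<alpha>\<in>\<Delta>. coeff \<alpha>\<^sub>0 \<alpha> = 1 \<longrightarrow> \<langle>y, \<alpha>\<^sub>0\<rangle> + \<langle>y, \<alpha>\<rangle> \<le> 1)"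
  by (auto simp: coweight_polytope_def dominant_def blinfun.bilinear_simps)

lemma polytope_F: "polytope F"
proof (rule polytope_dual_halfspaces[where S = \<Delta> and K = "\<lambda>_. 1"])
  let ?H = "insert (\<alpha>\<^sub>0, 1) ((\<lambda>\<alpha>. (- \<alpha>, 0)) ` \<Delta> \<union> (\<lambda>\<alpha>. (\<alpha>\<^sub>0 + \<alpha>, 1)) ` {\<alpha> \<in> \<Delta>. coeff \<alpha>\<^sub>0 \<alpha> = 1})"
  show "finite ?H"
    using finite_simple by simp
  show "F = {y. \<forall>(v, c)\<in>?H. \<langle>y, v\<rangle> \<le> c}"
    unfolding coweight_polytope_def
    by (rule Collect_cong) (simp add: ball_Un blinfun.minus_right, blast)
  show "span \<Delta> = UNIV"
    by (rule span_simple)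
  show "\<bar>\<langle>y, \<alpha>\<rangle>\<bar> \<le> 1" if "y \<in> F" "\<alpha> \<in> \<Delta>" for y \<alpha>
    using that dominant_pairing_le_highest[of y \<alpha>] simple_root
    by (force simp: F_iff dominant_def)
qed

lemma interior_F:
  assumes y: "y \<in> interior F"
  shows "\<alpha> \<in> \<Delta> \<Longrightarrow> 0 < \<langle>y, \<alpha>\<rangle>"
    and "\<langle>y, \<alpha>\<^sub>0\<rangle> < 1"
    and "\<alpha> \<in> \<Delta> \<Longrightarrow> coeff \<alpha>\<^sub>0 \<alpha> = 1 \<Longrightarrow> \<langle>y, \<alpha>\<^sub>0\<rangle> + \<langle>y, \<alpha>\<rangle> < 1"
proof -
  show "\<langle>y, \<alpha>\<^sub>0\<rangle> < 1"
    by (rule interior_strict_halfspace[OF y]) (use highest_root zero_not_root in \<open>auto simp: F_iff\<close>)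
  assume \<alpha>: "\<alpha> \<in> \<Delta>"
  have "\<langle>y, - \<alpha>\<rangle> < 0"
    by (rule interior_strict_halfspace[OF y])
      (use \<alpha> simple_root zero_not_root in \<open>auto simp: F_iff dominant_def blinfun.minus_right\<close>)
  then show "0 < \<langle>y, \<alpha>\<rangle>"
    by (simp add: blinfun.minus_right)
  assume 1: "coeff \<alpha>\<^sub>0 \<alpha> = 1"
  have "coeff (\<alpha>\<^sub>0 + \<alpha>) \<alpha> \<noteq> 0"
    unfolding coeff_add by (simp add: coeff_simple \<alpha> 1)
  then have "\<alpha>\<^sub>0 + \<alpha> \<noteq> 0"
    by (metis representation_zero)
  then have "\<langle>y, \<alpha>\<^sub>0 + \<alpha>\<rangle> < 1"
    by (intro interior_strict_halfspace[OF y]) (use \<alpha> 1 in \<open>auto simp: F_iff blinfun.add_right\<close>)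
  then show "\<langle>y, \<alpha>\<^sub>0\<rangle> + \<langle>y, \<alpha>\<rangle> < 1"
    by (simp add: blinfun.add_right)
qed

text \<open>
  For \<open>y\<close> in the polytope, both \<open>1\<close> and \<open>1 - \<langle>y, \<alpha>\<rangle>\<close> are at least the gauge of \<open>y\<close>, so translating
  \<open>y\<close> by a non-zero coweight \<open>\<mu>\<close> does not decrease the gauge. The only delicate case is that \<open>\<mu>\<close>
  is the negative of a minuscule fundamental coweight, and this is where the walls
  \<open>\<langle>y, \<alpha>\<^sub>0 + \<alpha>\<rangle> = 1\<close> come from.
\<close>

lemma gauge_translate_cases:
  assumes y: "y \<in> F" and \<mu>: "\<mu> \<in> coweight_lattice \<Phi>" "\<mu> \<noteq> 0"
  shows "1 \<le> gauge (y + \<mu>) \<or> (\<exists>\<alpha>\<in>\<Delta>. coeff \<alpha>\<^sub>0 \<alpha> = 1 \<and> 1 - \<langle>y, \<alpha>\<rangle> \<le> gauge (y + \<mu>))"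
proof -
  have dom: "dominant y" and le1: "\<langle>y, \<alpha>\<^sub>0\<rangle> \<le> 1"
    using y by (auto simp: F_iff)
  have int: "\<langle>\<mu>, \<beta>\<rangle> \<in> \<int>" if "\<beta> \<in> \<Phi>" for \<beta>
    using \<mu> that by (simp add: coweight_lattice_def)
  have ge: "\<langle>y, \<beta>\<rangle> + \<langle>\<mu>, \<beta>\<rangle> \<le> gauge (y + \<mu>)" if "\<beta> \<in> \<Phi>" for \<beta>
    using gauge_ge[OF that, of "y + \<mu>"] by (simp add: blinfun.add_left)
  consider (two) \<beta> where "\<beta> \<in> \<Phi>" "1 < \<langle>\<mu>, \<beta>\<rangle>"
    | (pos) \<beta> where "positive \<beta>" "0 < \<langle>\<mu>, \<beta>\<rangle>"
    | (antidominant) "\<And>\<beta>. \<beta> \<in> \<Phi> \<Longrightarrow> \<langle>\<mu>, \<beta>\<rangle> \<le> 1" "\<And>\<beta>. positive \<beta> \<Longrightarrow> \<langle>\<mu>, \<beta>\<rangle> \<le> 0"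
    by (meson not_le)
  then show ?thesis
  proof cases
    case two
    then have "2 \<le> \<langle>\<mu>, \<beta>\<rangle>"
      using int[of \<beta>] by (auto elim!: Ints_cases)
    moreover have "\<langle>y, -\<beta>\<rangle> \<le> \<langle>y, \<alpha>\<^sub>0\<rangle>"
      using dom two uminus_root by (intro dominant_pairing_le_highest)
    ultimately show ?thesis
      using ge[of \<beta>] le1 two by (simp add: blinfun.minus_right)
  next
    case pos
    then have \<beta>: "\<beta> \<in> \<Phi>"
      by (simp add: positive_def)
    then have "1 \<le> \<langle>\<mu>, \<beta>\<rangle>"
      using int[of \<beta>] pos by (auto elim!: Ints_cases)
    moreover have "0 \<le> \<langle>y, \<beta>\<rangle>"
      unfolding pairing_expand[of y \<beta>] using pos dom
      by (intro sum_nonneg mult_nonneg_nonneg) (auto simp: positive_def dominant_def)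
    ultimately show ?thesis
      using ge[of \<beta>] \<beta> by simp
  next
    case antidominant
    obtain \<alpha> where \<alpha>: "\<alpha> \<in> \<Delta>" "\<langle>\<mu>, \<alpha>\<rangle> \<noteq> 0"
      using \<mu>(2) blinfun_eqI_span[OF span_simple, of \<mu> 0] by auto
    have nonpos: "\<langle>\<mu>, \<gamma>\<rangle> \<le> 0" if "\<gamma> \<in> \<Delta>" for \<gamma>
      using that antidominant(2) simple_positive by blast
    have ge1: "1 \<le> - \<langle>\<mu>, \<alpha>\<rangle>"
      using int[OF simple_root[OF \<alpha>(1)]] nonpos[OF \<alpha>(1)] \<alpha>(2) by (auto elim!: Ints_cases)
    have "coeff \<alpha>\<^sub>0 \<alpha> * 1 \<le> coeff \<alpha>\<^sub>0 \<alpha> * (- \<langle>\<mu>, \<alpha>\<rangle>)"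
      using ge1 highest_coeff_ge_1[OF \<alpha>(1)] by (intro mult_left_mono) auto
    also have "\<dots> \<le> (\<Sum>\<gamma>\<in>\<Delta>. coeff \<alpha>\<^sub>0 \<gamma> * (- \<langle>\<mu>, \<gamma>\<rangle>))"
    proof (rule member_le_sum[OF \<alpha>(1) _ finite_simple])
      show "0 \<le> coeff \<alpha>\<^sub>0 \<gamma> * (- \<langle>\<mu>, \<gamma>\<rangle>)" if "\<gamma> \<in> \<Delta> - {\<alpha>}" for \<gamma>
        using that nonpos[of \<gamma>] highest_coeff_ge_1[of \<gamma>] by (intro mult_nonneg_nonneg) auto
    qed
    also have "\<dots> = \<langle>\<mu>, - \<alpha>\<^sub>0\<rangle>"
      by (simp add: blinfun.minus_right pairing_expand[of \<mu> \<alpha>\<^sub>0] sum_negf)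
    also have "\<dots> \<le> 1"
      using antidominant(1) highest_root uminus_root by blast
    finally have "coeff \<alpha>\<^sub>0 \<alpha> = 1"
      using highest_coeff_ge_1[OF \<alpha>(1)] by simp
    moreover have "1 - \<langle>y, \<alpha>\<rangle> \<le> gauge (y + \<mu>)"
      using ge[OF uminus_root[OF simple_root[OF \<alpha>(1)]]] ge1 by (simp add: blinfun.minus_right)
    ultimately show ?thesis
      using \<alpha>(1) by blast
  qed
qed

lemma gauge_translate:
  assumes "y \<in> F" "\<mu> \<in> coweight_lattice \<Phi>"
  shows "gauge y \<le> gauge (y + \<mu>)"
proof (cases "\<mu> = 0")
  case False
  have "gauge y \<le> 1" "\<forall>\<alpha>\<in>\<Delta>. coeff \<alpha>\<^sub>0 \<alpha> = 1 \<longrightarrow> gauge y \<le> 1 - \<langle>y, \<alpha>\<rangle>"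
    using assms(1) gauge_dominant[of y] by (auto simp: F_iff algebra_simps)
  then show ?thesis
    using gauge_translate_cases[OF assms False] by (meson order_trans)
qed simp

lemma gauge_translate_interior:
  assumes y: "y \<in> interior F" and "\<mu> \<in> coweight_lattice \<Phi>" "\<mu> \<noteq> 0"
  shows "gauge y < gauge (y + \<mu>)"
proof -
  have F: "y \<in> F"
    using y interior_subset by blast
  then have "gauge y = \<langle>y, \<alpha>\<^sub>0\<rangle>"
    using gauge_dominant[of y] by (simp add: F_iff)
  then have "gauge y < 1" "\<forall>\<alpha>\<in>\<Delta>. coeff \<alpha>\<^sub>0 \<alpha> = 1 \<longrightarrow> gauge y < 1 - \<langle>y, \<alpha>\<rangle>"
    using interior_F[OF y] by (auto simp: algebra_simps)
  then show ?thesis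
    using gauge_translate_cases[OF F assms(2,3)] by (meson less_le_trans)
qed

lemma interior_F_moves_out:
  assumes y: "y \<in> interior F" and as: "set as \<subseteq> \<Delta>" and l: "l \<in> coweight_lattice \<Phi>"
    and wy: "affine_word as l y \<in> F"
  shows "affine_word as l = (\<lambda>z. z)"
proof -
  have root: "set as \<subseteq> \<Phi>" "set (rev as) \<subseteq> \<Phi>"
    using as simple_subset by auto
  have "l = 0"
  proof (rule ccontr)
    assume "l \<noteq> 0"
    define \<mu> where "\<mu> = dual_word (rev as) l"
    have to_l: "dual_word as \<mu> = l"
      using dual_word_rev[OF root(2)] by (simp add: \<mu>_def)
    have "\<mu> \<noteq> 0"
    proof
      assume "\<mu> = 0"
      have "dual_word as 0 = 0"
        using dual_word_diff[of as 0 0] by simp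
      then show False
        using \<open>\<mu> = 0\<close> to_l \<open>l \<noteq> 0\<close> by simp
    qed
    have "gauge (dual_word as y + l) \<le> gauge (dual_word as y + l + - l)"
      using wy l by (intro gauge_translate coweight_lattice_uminus) (auto simp: affine_word_def)
    also have "\<dots> = gauge y"
      by (simp add: gauge_dual_word root)
    also have "\<dots> < gauge (y + \<mu>)"
      using y l root \<open>\<mu> \<noteq> 0\<close> unfolding \<mu>_def
      by (intro gauge_translate_interior coweight_lattice_dual_word)
    also have "\<dots> = gauge (dual_word as (y + \<mu>))"
      by (simp add: gauge_dual_word root)
    finally show False
      by (simp add: dual_word_add to_l)
  qed
  moreover have "dual_word as = (\<lambda>z. z)"
  proof (rule dual_word_trivial[OF as])
    show "0 < \<langle>y, \<alpha>\<rangle>" if "\<alpha> \<in> \<Delta>" for \<alpha>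
      using interior_F(1)[OF y that] .
    show "dominant (dual_word as y)"
      using wy \<open>l = 0\<close> by (simp add: affine_word_def F_iff)
  qed
  ultimately show ?thesis
    by (simp add: affine_word_def fun_eq_iff)
qed

section \<open>Covering\<close>

text \<open>
  The coset of \<open>y\<close> modulo the coweight lattice has a point that is minimal for the gauge and, among
  those, for the form. The form breaks ties: subtracting the highest coroot need not change the gauge
  of a point if the gauge is attained at a root on which this coroot vanishes.
\<close>

lemma ex_minimal_translate:
  obtains l where "l \<in> coweight_lattice \<Phi>"
    and "\<And>m. m \<in> coweight_lattice \<Phi> \<Longrightarrow> gauge (y + l) \<le> gauge (y + l + m)"
    and "\<And>m. m \<in> coweight_lattice \<Phi> \<Longrightarrow> gauge (y + l + m) = gauge (y + l) \<Longrightarrow>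
           form (y + l) (y + l) \<le> form (y + l + m) (y + l + m)"
proof -
  define S where "S = {l \<in> coweight_lattice \<Phi>. gauge (y + l) \<le> gauge y}"
  have "finite {l. \<forall>\<beta>\<in>\<Phi>. \<langle>l, \<beta>\<rangle> \<in> {x \<in> \<int>. - 2 * gauge y \<le> x \<and> x \<le> 2 * gauge y}}"
    by (intro finite_blinfuns_with_finite_values finite_roots span_roots finite_int_segment)
  moreover have "\<bar>\<langle>l, \<beta>\<rangle>\<bar> \<le> 2 * gauge y" if "l \<in> S" "\<beta> \<in> \<Phi>" for l \<beta>
    using abs_pairing_le_gauge[OF that(2), of "y + l"] abs_pairing_le_gauge[OF that(2), of y] that(1)
    by (auto simp: S_def blinfun.add_left abs_le_iff)
  then have "S \<subseteq> {l. \<forall>\<beta>\<in>\<Phi>. \<langle>l, \<beta>\<rangle> \<in> {x \<in> \<int>. - 2 * gauge y \<le> x \<and> x \<le> 2 * gauge y}}"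
    by (force simp: S_def coweight_lattice_def abs_le_iff)
  ultimately have fin: "finite S"
    by (rule finite_subset[rotated])
  have "0 \<in> S"
    by (simp add: S_def coweight_lattice_zero)
  then obtain l1 where l1: "l1 \<in> S" "\<And>l. l \<in> S \<Longrightarrow> gauge (y + l1) \<le> gauge (y + l)"
    using ex_min_if_finite[of "(\<lambda>l. gauge (y + l)) ` S"] fin by (auto simp: not_less)
  define S' where "S' = {l \<in> S. gauge (y + l) = gauge (y + l1)}"
  have "finite S'" "l1 \<in> S'"
    using fin l1 by (auto simp: S'_def)
  then obtain l where l: "l \<in> S'"
      "\<And>l'. l' \<in> S' \<Longrightarrow> form (y + l) (y + l) \<le> form (y + l') (y + l')"
    using ex_min_if_finite[of "(\<lambda>l. form (y + l) (y + l)) ` S'"] by (auto simp: not_less)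
  have lS: "l \<in> S" "l \<in> coweight_lattice \<Phi>" "gauge (y + l) = gauge (y + l1)"
    using l(1) by (auto simp: S'_def S_def)
  show thesis
  proof (rule that[of l])
    show "l \<in> coweight_lattice \<Phi>"
      by fact
    fix m assume m: "m \<in> coweight_lattice \<Phi>"
    have lm: "l + m \<in> coweight_lattice \<Phi>"
      using lS m by (simp add: coweight_lattice_add)
    show "gauge (y + l) \<le> gauge (y + l + m)"
    proof (cases "l + m \<in> S")
      case True
      then show ?thesis
        using l1(2) lS by (simp add: add.assoc)
    next
      case False
      then have "gauge y < gauge (y + l + m)"
        using lm by (simp add: S_def add.assoc)
      then show ?thesis
        using lS(1) by (simp add: S_def)
    qed
    assume "gauge (y + l + m) = gauge (y + l)"
    then have "l + m \<in> S'"
      using lS lm by (simp add: S'_def S_def add.assoc)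
    then show "form (y + l) (y + l) \<le> form (y + l + m) (y + l + m)"
      using l(2) by (simp add: add.assoc)
  qed
qed

lemma minimal_dominant_in_alcove:
  assumes dom: "dominant x"
    and gauge_min: "\<And>m. m \<in> coweight_lattice \<Phi> \<Longrightarrow> gauge x \<le> gauge (x + m)"
    and form_min: "\<And>m. m \<in> coweight_lattice \<Phi> \<Longrightarrow> gauge (x + m) = gauge x \<Longrightarrow>
                     form x x \<le> form (x + m) (x + m)"
  shows "\<langle>x, \<alpha>\<^sub>0\<rangle> \<le> 1"
proof (rule ccontr)
  \<comment> \<open>Translation by the negative of the highest coroot keeps the gauge and decreases the form.\<close>
  assume gt: "\<not> \<langle>x, \<alpha>\<^sub>0\<rangle> \<le> 1"
  let ?c = "coroot \<Phi> \<alpha>\<^sub>0"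
  have c: "- ?c \<in> coweight_lattice \<Phi>"
    by (intro coweight_lattice_uminus)
      (simp add: coweight_lattice_def coroot_integral highest_root)
  have "gauge (x + - ?c) \<le> gauge x"
  proof (rule gauge_le)
    fix \<beta> assume \<beta>: "\<beta> \<in> \<Phi>"
    show "\<langle>x + - ?c, \<beta>\<rangle> \<le> gauge x"
    proof (cases "0 \<le> \<langle>?c, \<beta>\<rangle>")
      case True
      then show ?thesis
        using gauge_ge[OF \<beta>, of x] by (simp add: blinfun.bilinear_simps)
    next
      case False
      have "\<langle>x, \<beta>\<rangle> - \<langle>?c, \<beta>\<rangle> * \<langle>x, \<alpha>\<^sub>0\<rangle> \<le> gauge x"
        using gauge_ge[OF reflection_root[OF highest_root \<beta>], of x]
        by (simp add: reflection_def blinfun.bilinear_simps)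
      moreover have "\<langle>?c, \<beta>\<rangle> * \<langle>x, \<alpha>\<^sub>0\<rangle> \<le> \<langle>?c, \<beta>\<rangle> * 1"
        using False gt by (intro mult_left_mono_neg) auto
      ultimately show ?thesis
        by (simp add: blinfun.bilinear_simps)
    qed
  qed
  then have "form x x \<le> form (x - ?c) (x - ?c)"
    using gauge_min[OF c] form_min[OF c] by simp
  also have "\<dots> = form x x - 2 * form x ?c + form ?c ?c"
    by (simp add: form_diff_left form_diff_right form_commute)
  also have "\<dots> = form x x - (\<langle>x, \<alpha>\<^sub>0\<rangle> - 1) * form ?c ?c"
    by (simp add: form_coroot[OF highest_root] algebra_simps)
  finally have "(\<langle>x, \<alpha>\<^sub>0\<rangle> - 1) * form ?c ?c \<le> 0"
    by simp
  then show False
    using gt form_coroot_pos[OF highest_root] by (simp add: mult_le_0_iff)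
qed

text \<open>
  For a minuscule fundamental coweight \<open>\<omega>\<close> and \<open>x\<close> in the fundamental alcove, \<open>x - \<omega>\<close> lies in the
  closed chamber whose highest root is \<open>- \<alpha>\<close>.
\<close>

lemma gauge_diff_minuscule:
  assumes dom: "dominant x" and le1: "\<langle>x, \<alpha>\<^sub>0\<rangle> \<le> 1"
    and \<alpha>: "\<alpha> \<in> \<Delta>" "coeff \<alpha>\<^sub>0 \<alpha> = 1" and \<omega>: "\<And>v. \<langle>\<omega>, v\<rangle> = coeff v \<alpha>"
  shows "gauge (x - \<omega>) \<le> 1 - \<langle>x, \<alpha>\<rangle>"
proof (rule gauge_le)
  fix \<beta> assume \<beta>: "\<beta> \<in> \<Phi>"
  have "coeff \<beta> \<alpha> \<le> 1" "- coeff \<beta> \<alpha> \<le> 1"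
    using coeff_le_highest[OF \<beta> \<alpha>(1)] coeff_le_highest[OF uminus_root[OF \<beta>] \<alpha>(1)] \<alpha>(2)
    by (simp_all add: coeff_uminus)
  moreover obtain k where k: "coeff \<beta> \<alpha> = of_int k"
    using coeff_integral[OF \<beta> \<alpha>(1)] by (auto elim!: Ints_cases)
  ultimately have "k = 1 \<or> k = 0 \<or> k = -1"
    by linarith
  then consider "coeff \<beta> \<alpha> = 1" | "coeff \<beta> \<alpha> = 0" | "coeff \<beta> \<alpha> = -1"
    using k by auto
  then have "\<langle>x, \<beta>\<rangle> - coeff \<beta> \<alpha> \<le> 1 - \<langle>x, \<alpha>\<rangle>"
  proof cases
    case 1
    then show ?thesis
      using dominant_pairing_le_highest[OF dom \<beta>]
        dominant_pairing_le_highest[OF dom simple_root[OF \<alpha>(1)]] le1 by simp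
  next
    case 2
    have "\<langle>x, \<beta> + \<alpha>\<rangle> \<le> \<langle>x, \<alpha>\<^sub>0\<rangle>"
      using 2 \<alpha> coeff_le_highest[OF \<beta>]
      by (intro dominant_pairing_mono[OF dom]) (auto simp: coeff_add coeff_simple)
    then show ?thesis
      using 2 le1 by (simp add: blinfun.add_right)
  next
    case 3
    then have "\<not> positive \<beta>"
      using \<alpha>(1) by (auto simp: positive_def intro!: bexI[of _ \<alpha>])
    then have "positive (- \<beta>)"
      using positive_cases[OF \<beta>] by blast
    then have "\<langle>x, \<alpha>\<rangle> \<le> \<langle>x, - \<beta>\<rangle>"
      using 3 \<alpha>(1)
      by (intro dominant_pairing_mono[OF dom]) (auto simp: positive_def coeff_uminus coeff_simple)
    then show ?thesis
      using 3 by (simp add: blinfun.minus_right)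
  qed
  then show "\<langle>x - \<omega>, \<beta>\<rangle> \<le> 1 - \<langle>x, \<alpha>\<rangle>"
    by (simp add: blinfun.diff_left \<omega>)
qed

lemma minimal_dominant_in_F:
  assumes dom: "dominant x"
    and gauge_min: "\<And>m. m \<in> coweight_lattice \<Phi> \<Longrightarrow> gauge x \<le> gauge (x + m)"
    and form_min: "\<And>m. m \<in> coweight_lattice \<Phi> \<Longrightarrow> gauge (x + m) = gauge x \<Longrightarrow>
                     form x x \<le> form (x + m) (x + m)"
  shows "x \<in> F"
  unfolding F_iff
proof (intro conjI ballI impI dom)
  show le1: "\<langle>x, \<alpha>\<^sub>0\<rangle> \<le> 1"
    using minimal_dominant_in_alcove assms by blast
  fix \<alpha> assume \<alpha>: "\<alpha> \<in> \<Delta>" "coeff \<alpha>\<^sub>0 \<alpha> = 1"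
  obtain \<omega> where \<omega>: "\<And>v. \<langle>\<omega>, v\<rangle> = coeff v \<alpha>"
    using ex_fundamental_coweight by blast
  then have "- \<omega> \<in> coweight_lattice \<Phi>"
    using coeff_integral \<alpha>(1) by (intro coweight_lattice_uminus) (simp add: coweight_lattice_def)
  then have "\<langle>x, \<alpha>\<^sub>0\<rangle> \<le> gauge (x - \<omega>)"
    using gauge_min[of "- \<omega>"] gauge_dominant[OF dom] by simp
  also have "\<dots> \<le> 1 - \<langle>x, \<alpha>\<rangle>"
    using gauge_diff_minuscule[OF dom le1 \<alpha> \<omega>] .
  finally show "\<langle>x, \<alpha>\<^sub>0\<rangle> + \<langle>x, \<alpha>\<rangle> \<le> 1"
    by simp
qed

lemma F_covers:
  "\<exists>as l z. set as \<subseteq> \<Delta> \<and> l \<in> coweight_lattice \<Phi> \<and> z \<in> F \<and> y = affine_word as l z"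
proof -
  obtain l where l: "l \<in> coweight_lattice \<Phi>"
    and gauge_min: "\<And>m. m \<in> coweight_lattice \<Phi> \<Longrightarrow> gauge (y + l) \<le> gauge (y + l + m)"
    and form_min: "\<And>m. m \<in> coweight_lattice \<Phi> \<Longrightarrow> gauge (y + l + m) = gauge (y + l) \<Longrightarrow>
           form (y + l) (y + l) \<le> form (y + l + m) (y + l + m)"
    using ex_minimal_translate[of y] by metis
  obtain as where as: "set as \<subseteq> \<Delta>" and dom: "dominant (dual_word as (y + l))"
    using ex_dominant by blast
  have root: "set as \<subseteq> \<Phi>" "set (rev as) \<subseteq> \<Phi>"
    using as simple_subset by auto
  have shift: "dual_word as (y + l) + m = dual_word as (y + l + dual_word (rev as) m)" for m
    using dual_word_rev[OF root(2), of m] by (simp add: dual_word_add)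
  have "dual_word as (y + l) \<in> F"
  proof (rule minimal_dominant_in_F[OF dom])
    fix m assume "m \<in> coweight_lattice \<Phi>"
    then have m: "dual_word (rev as) m \<in> coweight_lattice \<Phi>"
      using root by (simp add: coweight_lattice_dual_word)
    show "gauge (dual_word as (y + l)) \<le> gauge (dual_word as (y + l) + m)"
      unfolding shift gauge_dual_word[OF root(1)] using gauge_min[OF m] .
    assume "gauge (dual_word as (y + l) + m) = gauge (dual_word as (y + l))"
    then show "form (dual_word as (y + l)) (dual_word as (y + l)) \<le>
        form (dual_word as (y + l) + m) (dual_word as (y + l) + m)"
      unfolding shift gauge_dual_word[OF root(1)] form_dual_word[OF root(1)] by (rule form_min[OF m])
  qed
  moreover have "y = affine_word (rev as) (- l) (dual_word as (y + l))"
    by (simp add: affine_word_def dual_word_rev[OF root(1)])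
  ultimately show ?thesis
    using as l coweight_lattice_uminus by (metis set_rev)
qed

lemma fundamental_domain_F:
  "fundamental_domain (extended_affine_weyl_group \<Phi>) (\<lambda>w. w) F"
  unfolding fundamental_domain_def
proof (intro conjI ballI impI)
  let ?E = "extended_affine_weyl_group \<Phi>"
  show action: "group_action ?E UNIV (\<lambda>w. w)"
    by (rule group_action_extended_affine_weyl_group)
  show "continuous_on UNIV w" if "w \<in> carrier ?E" for w
    using that continuous_affine_word by (auto simp: carrier_extended_affine_weyl_group)
  obtain X where "finite X" "F = convex hull X"
    using polytope_F by (auto simp: polytope_def)
  then show "closed F" "connected F"
    by (simp_all add: finite_imp_compact_convex_hull compact_imp_closed convex_connected)
  show "interior (F \<inter> w ` F) = {}" if w: "w \<in> carrier ?E" "w \<noteq> \<one>\<^bsub>?E\<^esub>" for w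
  proof (rule ccontr)
    assume "interior (F \<inter> w ` F) \<noteq> {}"
    then obtain x where "x \<in> interior (F \<inter> w ` F)"
      by blast
    then have x: "x \<in> interior F" and "x \<in> w ` F"
      using interior_mono[of "F \<inter> w ` F" F] interior_subset by blast+
    then obtain z where z: "z \<in> F" "x = w z"
      by blast
    obtain as l where as: "set as \<subseteq> \<Delta>" "l \<in> coweight_lattice \<Phi>" and w_eq: "w = affine_word as l"
      using w(1) by (auto simp: carrier_extended_affine_weyl_group)
    have root: "set as \<subseteq> \<Phi>"
      using as simple_subset by blast
    let ?v = "affine_word (rev as) (- dual_word (rev as) l)"
    have "?v x = z"
      by (simp add: z w_eq affine_word_inverse root)
    then have "?v = (\<lambda>z. z)"
      using as root z x
      by (intro interior_F_moves_out[of x])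
        (auto intro!: coweight_lattice_uminus coweight_lattice_dual_word)
    then have "w u = u" for u
      using affine_word_inverse(1)[OF root, of l u] unfolding w_eq by metis
    then show False
      using w(2) by (simp add: one_extended_affine_weyl_group fun_eq_iff)
  qed
  have "y \<in> (\<Union>w\<in>carrier ?E. w ` F)" for y
  proof -
    obtain as l z where *: "set as \<subseteq> \<Delta>" "l \<in> coweight_lattice \<Phi>" "z \<in> F" "y = affine_word as l z"
      using F_covers[of y] by blast
    then have "affine_word as l \<in> carrier ?E"
      unfolding carrier_extended_affine_weyl_group by blast
    then show ?thesis
      using * by blast
  qed
  then show "(\<Union>w\<in>carrier ?E. w ` F) = UNIV"
    by blast
qed

end

theorem corollary2p2p9:
  fixes \<Phi> \<Delta> :: "'a::euclidean_space set" and \<alpha>\<^sub>0 :: 'a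
  assumes "crystallographic_root_system \<Phi>"
    and "reduced_roots \<Phi>"
    and "irreducible_roots \<Phi>"
    and "simple_system \<Phi> \<Delta>"
    and "highest_root \<Phi> \<Delta> \<alpha>\<^sub>0"
  shows "polytope (coweight_polytope \<Delta> \<alpha>\<^sub>0)
    \<and> fundamental_domain (extended_affine_weyl_group \<Phi>) (\<lambda>w. w) (coweight_polytope \<Delta> \<alpha>\<^sub>0)
    \<and> (\<forall>y \<in> interior (coweight_polytope \<Delta> \<alpha>\<^sub>0).
         \<forall>w \<in> carrier (extended_affine_weyl_group \<Phi>).
           w \<noteq> \<one>\<^bsub>extended_affine_weyl_group \<Phi>\<^esub> \<longrightarrow> w y \<notin> coweight_polytope \<Delta> \<alpha>\<^sub>0)"
proof -
  interpret highest_root_system \<Phi> \<Delta> \<alpha>\<^sub>0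
    by unfold_locales (fact assms)+
  have "w = \<one>\<^bsub>extended_affine_weyl_group \<Phi>\<^esub>"
    if "y \<in> interior F" "w \<in> carrier (extended_affine_weyl_group \<Phi>)" "w y \<in> F" for y w
    using that interior_F_moves_out
    by (auto simp: carrier_extended_affine_weyl_group one_extended_affine_weyl_group)
  then show ?thesis
    using polytope_F fundamental_domain_F by blast
qed

end
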